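(* For every $\mathbf n\in S^{d-1}$, for Lebesgue-almost all $\beta\ge0$, $$\limsup_{r\to0^+}\frac{I_{\beta,\mathbf n}(\tau^q_\beta(\mathbf n)-r)}{r^2}>0.$$
   Context: Fix $d\ge 2$, $q\ge 1$; $\beta\ge 0$. For $x,y\in\mathbb Z^d$ write $x\sim y$ if $\|x-y\|_2=1$; for $\Lambda\subset\mathbb Z^d$ let $E(\Lambda)=\{\{x,y\}:x,y\in\Lambda,\ x\sim y\}$. The couplings $J=(J_e)_{e\in E(\mathbb Z^d)}$ are i.i.d. with values in $[0,1]$ under the product measure $\mathbb P$. $J^{\min}=\inf\{\lambda\ge0:\mathbb P(J_e<\lambda)>0\}$. Random cluster model: for finite $E\subset E(\mathbb Z^d)$, boundary condition $\pi\in\{0,1\}^{E^c}$ and $\omega\in\{0,1\}^E$, $\Phi^{J,\pi,q}_{E,\beta}(\{\omega\})=\frac1Z\prod_{e\in E}p_e^{\omega_e}(1-p_e)^{1-\omega_e}\,q^{C^\pi_E(\omega)}$ with $p_e=1-e^{-\beta J_e}$, where $C^\pi_E(\omega)$ is the number of clusters of the set of vertices touched by $E$ when connections use the open edges of $\omega$ in $E$ and of $\pi$ outside $E$, and $Z$ is the normalizing constant. The boundary condition $w$ (wired) is $\pi\equiv1$. Geometry: $S^{d-1}$ is the Euclidean unit sphere. For $\mathbf n\in S^{d-1}$, $\mathbb S_{\mathbf n}$ is the set of the $(d-1)$-dimensional unit cubes $\{\sum_{k=1}^{d-1}t_k\mathbf u_k: t_k\in[-\frac12,\frac12]\}$ with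 $(\mathbf u_1,\dots,\mathbf u_{d-1},\mathbf n)$ an orthonormal basis of $\mathbb R^d$. $\mathcal R_{x,L,H}(\mathcal S,\mathbf n)=x+L\mathcal S+[-H,H]\mathbf n$. For such $\mathcal R$, $\hat{\mathcal R}$ is the set of points of $\mathbb Z^d$ in the interior of $\mathcal R$; $\partial\hat{\mathcal R}=\{y\in\hat{\mathcal R}:\exists z\in\mathbb Z^d\setminus\hat{\mathcal R},\ z\sim y\}$; $\partial^+\hat{\mathcal R}=\{y\in\partial\hat{\mathcal R}:(y-x)\cdot\mathbf n\ge0\}$, $\partial^-\hat{\mathcal R}=\{y\in\partial\hat{\mathcal R}:(y-x)\cdot\mathbf n<0\}$. $\Phi^{J,w}_{\mathcal R}$ is $\Phi^{J,w,q}_{E(\hat{\mathcal R}),\beta}$. Surface tension: $\mathcal D_{\mathcal R}$ is the event that no $\omega$-open path in $E(\hat{\mathcal R})$ joins $\partial^+\hat{\mathcal R}$ to $\partial^-\hat{\mathcal R}$, and $\tau^J_{\mathcal R}=-\frac1{L^{d-1}}\log\Phi^{J,w}_{\mathcal R}(\mathcal D_{\mathcal R})$. The quenched surface tension $\tau^q_\beta(\mathbf n)$ is the limit in $\mathbb P$-probability of $\tau^J_{\mathcal R_{0,N,\delta N}(\mathcal S,\mathbf n)}$ as $N\to\infty$ (it exists and does not depend on $\delta>0$, $\mathcal S\in\mathbb S_{\mathbf n}$); $\tau^{\min}(\mathbf n)$ is the same limit for the constant couplings $J\equiv J^{\min}$. Rate function: for $\tau>\tau^{\min}(\mathbf n)$,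 $I_{\beta,\mathbf n}(\tau)=\lim_{N}-\frac1{N^{d-1}}\log\mathbb P(\tau^J_{\mathcal R_{0,N,\delta N}(\mathcal S,\mathbf n)}\le\tau)\in[0,\infty)$ (it exists and does not depend on $\delta>0$, $\mathcal S\in\mathbb S_{\mathbf n}$); $I_{\beta,\mathbf n}(\tau)=+\infty$ for $\tau<\tau^{\min}(\mathbf n)$ and $I_{\beta,\mathbf n}(\tau^{\min}(\mathbf n))=\lim_{\varepsilon\to0^+}I_{\beta,\mathbf n}(\tau^{\min}(\mathbf n)+\varepsilon)$. *)

theory Defs
  imports "HOL-Probability.Probability"
begin

definition emb :: "int ^ 'd \<Rightarrow> real ^ 'd" where
  "emb z = (\<chi> i. real_of_int (z $ i))"

definition adjacent :: "int ^ 'd \<Rightarrow> int ^ 'd \<Rightarrow> bool" where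
  "adjacent x y \<longleftrightarrow> norm (emb x - emb y) = 1"

definition edges :: "(int ^ 'd) set \<Rightarrow> (int ^ 'd) set set" where
  "edges A = {{x, y} | x y. x \<in> A \<and> y \<in> A \<and> adjacent x y}"

text \<open>
  An edge configuration in \<open>{0,1}\<close> to the power \<open>E\<close> is encoded as the set of its open edges,
  a subset of \<open>E\<close>; boundary conditions are encoded in the same way as subsets of
  \<open>edges UNIV - E\<close>.
\<close>

definition connected_by :: "(int ^ 'd) set set \<Rightarrow> int ^ 'd \<Rightarrow> int ^ 'd \<Rightarrow> bool" where
  "connected_by \<omega> x y \<longleftrightarrow> (x, y) \<in> {(a, b). {a, b} \<in> \<omega>}\<^sup>*"

definition cluster_count ::
  "(int ^ 'd) set set \<Rightarrow> (int ^ 'd) set set \<Rightarrow> (int ^ 'd) set set \<Rightarrow> nat" where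
  "cluster_count E \<pi> \<omega> =
     card (\<Union>E // {(x, y). x \<in> \<Union>E \<and> y \<in> \<Union>E \<and> connected_by (\<omega> \<union> \<pi>) x y})"

definition rc_weight ::
  "((int ^ 'd) set \<Rightarrow> real) \<Rightarrow> (int ^ 'd) set set \<Rightarrow> real \<Rightarrow> real \<Rightarrow> (int ^ 'd) set set
     \<Rightarrow> (int ^ 'd) set set \<Rightarrow> real" where
  "rc_weight J \<pi> q \<beta> E \<omega> =
     (let p = (\<lambda>e. 1 - exp (- \<beta> * J e))
      in (\<Prod>e\<in>E. if e \<in> \<omega> then p e else 1 - p e) * q ^ cluster_count E \<pi> \<omega>)"

definition random_cluster ::
  "((int ^ 'd) set \<Rightarrow> real) \<Rightarrow> (int ^ 'd) set set \<Rightarrow> real \<Rightarrow> real \<Rightarrow> (int ^ 'd) set set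
     \<Rightarrow> (int ^ 'd) set set measure" where
  "random_cluster J \<pi> q \<beta> E =
     point_measure (Pow E)
       (\<lambda>\<omega>. ennreal (rc_weight J \<pi> q \<beta> E \<omega> / (\<Sum>\<eta>\<in>Pow E. rc_weight J \<pi> q \<beta> E \<eta>)))"

definition wired :: "(int ^ 'd) set set \<Rightarrow> (int ^ 'd) set set" where
  "wired E = edges UNIV - E"

definition unit_cubes :: "real ^ 'd \<Rightarrow> (real ^ 'd) set set" where
  "unit_cubes n =
     {{\<Sum>u\<in>B - {n}. t u *\<^sub>R u | t. \<forall>u\<in>B - {n}. t u \<in> {-1/2..1/2}} | B.
        pairwise orthogonal B \<and> (\<forall>b\<in>B. norm b = 1) \<and> span B = UNIV \<and> n \<in> B}"

definition parallelepiped ::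
  "real ^ 'd \<Rightarrow> real \<Rightarrow> real \<Rightarrow> (real ^ 'd) set \<Rightarrow> real ^ 'd \<Rightarrow> (real ^ 'd) set" where
  "parallelepiped x L H S n = {x + L *\<^sub>R s + t *\<^sub>R n | s t. s \<in> S \<and> t \<in> {-H..H}}"

definition lattice_points :: "(real ^ 'd) set \<Rightarrow> (int ^ 'd) set" where
  "lattice_points R = {z. emb z \<in> interior R}"

definition inner_boundary :: "(int ^ 'd) set \<Rightarrow> (int ^ 'd) set" where
  "inner_boundary A = {y \<in> A. \<exists>z. z \<notin> A \<and> adjacent z y}"

definition upper_boundary ::
  "real ^ 'd \<Rightarrow> real ^ 'd \<Rightarrow> (int ^ 'd) set \<Rightarrow> (int ^ 'd) set" where
  "upper_boundary x n A = {y \<in> inner_boundary A. (emb y - x) \<bullet> n \<ge> 0}"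

definition lower_boundary ::
  "real ^ 'd \<Rightarrow> real ^ 'd \<Rightarrow> (int ^ 'd) set \<Rightarrow> (int ^ 'd) set" where
  "lower_boundary x n A = {y \<in> inner_boundary A. (emb y - x) \<bullet> n < 0}"

definition disconnection ::
  "real ^ 'd \<Rightarrow> real ^ 'd \<Rightarrow> (int ^ 'd) set \<Rightarrow> (int ^ 'd) set set set" where
  "disconnection x n A =
     {\<omega> \<in> Pow (edges A).
        \<not> (\<exists>a\<in>upper_boundary x n A. \<exists>b\<in>lower_boundary x n A. connected_by \<omega> a b)}"

definition surface_tension ::
  "((int ^ 'd) set \<Rightarrow> real) \<Rightarrow> real \<Rightarrow> real \<Rightarrow> real ^ 'd \<Rightarrow> real \<Rightarrow> real
     \<Rightarrow> (real ^ 'd) set \<Rightarrow> real ^ 'd \<Rightarrow> real" where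
  "surface_tension J q \<beta> x L H S n =
     (let A = lattice_points (parallelepiped x L H S n);
          E = edges A
      in - (1 / L ^ (CARD('d) - 1)) *
           ln (measure (random_cluster J (wired E) q \<beta> E) (disconnection x n A)))"

text \<open>\<open>\<mu>\<close> is the law of a single coupling, a probability measure on \<open>[0,1]\<close>.\<close>

definition couplings :: "real measure \<Rightarrow> ((int ^ 'd) set \<Rightarrow> real) measure" where
  "couplings \<mu> = PiM (edges UNIV) (\<lambda>_. \<mu>)"

definition J_min :: "real measure \<Rightarrow> real" where
  "J_min \<mu> = Inf {l. l \<ge> 0 \<and> measure \<mu> {j \<in> space \<mu>. j < l} > 0}"

text \<open>
  The surface tensions and the rate function are limits that exist and do not depend on
  \<open>\<delta>\<close> and \<open>S\<close>; as usual for limits, they are introduced through the relation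
  "is the limit", which determines them uniquely since \<open>unit_cubes n\<close> is nonempty when
  \<open>norm n = 1\<close>.
\<close>

definition is_quenched_surface_tension ::
  "real measure \<Rightarrow> real \<Rightarrow> real \<Rightarrow> real ^ 'd \<Rightarrow> real \<Rightarrow> bool" where
  "is_quenched_surface_tension \<mu> q \<beta> n \<tau> \<longleftrightarrow>
     (\<forall>\<delta>>0. \<forall>S\<in>unit_cubes n. \<forall>\<epsilon>>0.
        (\<lambda>N::nat. measure (couplings \<mu>)
           {J \<in> space (couplings \<mu>).
              \<bar>surface_tension J q \<beta> 0 (real N) (\<delta> * real N) S n - \<tau>\<bar> > \<epsilon>}) \<longlonglongrightarrow> 0)"

text \<open>For constant couplings the limit in probability is an ordinary limit.\<close>

definition is_minimal_surface_tension ::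
  "real measure \<Rightarrow> real \<Rightarrow> real \<Rightarrow> real ^ 'd \<Rightarrow> real \<Rightarrow> bool" where
  "is_minimal_surface_tension \<mu> q \<beta> n \<tau> \<longleftrightarrow>
     (\<forall>\<delta>>0. \<forall>S\<in>unit_cubes n.
        (\<lambda>N::nat. surface_tension (\<lambda>_. J_min \<mu>) q \<beta> 0 (real N) (\<delta> * real N) S n)
          \<longlonglongrightarrow> \<tau>)"

text \<open>The guard gives \<open>- log 0 = \<infinity>\<close>, whereas \<open>ln 0 = 0\<close> in the library.\<close>

definition neg_log :: "real \<Rightarrow> ereal" where
  "neg_log p = (if p = 0 then \<infinity> else ereal (- ln p))"

definition is_rate_function ::
  "real measure \<Rightarrow> real \<Rightarrow> real \<Rightarrow> real ^ 'd \<Rightarrow> real \<Rightarrow> (real \<Rightarrow> ereal) \<Rightarrow> bool" where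
  "is_rate_function \<mu> q \<beta> n \<tau>min I \<longleftrightarrow>
     (\<forall>\<tau>>\<tau>min. 0 \<le> I \<tau> \<and> I \<tau> < \<infinity> \<and>
        (\<forall>\<delta>>0. \<forall>S\<in>unit_cubes n.
           (\<lambda>N::nat. neg_log (measure (couplings \<mu>)
              {J \<in> space (couplings \<mu>).
                 surface_tension J q \<beta> 0 (real N) (\<delta> * real N) S n \<le> \<tau>})
              / ereal (real N ^ (CARD('d) - 1))) \<longlonglongrightarrow> I \<tau>)) \<and>
     (\<forall>\<tau><\<tau>min. I \<tau> = \<infinity>) \<and>
     ((\<lambda>\<epsilon>. I (\<tau>min + \<epsilon>)) \<longlongrightarrow> I \<tau>min) (at_right 0)"

end

theory Submission
  imports Defs
begin

text \<open>
  The surface tension in a box of side \<open>N\<close> satisfies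
  \<open>exp (- \<tau>) = \<Phi>(D) powr (1 / N ^ (d - 1))\<close>, where \<open>\<Phi>(D)\<close> is the probability of disconnection. The
  theorem bounds the exponential rate of its lower deviations below by a quadratic, along a sequence of
  deviations tending to \<open>0\<close>; it rests on a comparison of moments of \<open>\<Phi>(D)\<close> at two temperatures
  (\<open>coupling_prob_moment_le\<close>): for
  \<open>\<beta>' = s * \<beta>\<close>, \<open>0 < r \<le> 1\<close> and \<open>p \<ge> 1\<close> with \<open>p * r * \<beta> \<le> 2 * (1 - s) * exp (- \<beta>)\<close>, the mean of
  \<open>\<Phi>\<^sub>\<beta>(D) powr (r * p)\<close> is at most the \<open>p\<close>-th power of the mean of \<open>\<Phi>\<^sub>\<beta>\<^sub>'(D) powr r\<close>. As with
  hypercontractive semigroups, a move in the parameter \<open>\<beta>\<close> pays for a larger exponent.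

  The comparison is proved one edge at a time. As a function of the probability \<open>t\<close> that an edge is
  open, \<open>\<Phi>(D)\<close> is a ratio of affine functions, and positive association (the four functions theorem,
  applied to the supermodular number of clusters) shows that it decreases, is at least
  \<open>1 - t\<close> times its value at \<open>0\<close>, and moves towards its value at \<open>0\<close> by a definite proportion when the coupling is scaled
  down. These properties pass to the power \<open>r\<close>, are linear in the resulting function, and are therefore
  preserved by averaging over other edges; so the one-dimensional inequality, which is elementary,
  tensorizes without loss (\<open>contracting_integral_powr_le\<close>).

  With \<open>r = 1 / N ^ (d - 1)\<close> and \<open>p\<close> proportional to \<open>N ^ (d - 1)\<close>, the Chernoff bound gives
  \<open>I (\<tau>q - r) \<ge> \<kappa> * (r - loss)\<close>, where \<open>\<kappa>\<close> is of order \<open>\<beta> - \<beta>'\<close> and the loss is the decrease of the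
  effective tension from \<open>\<beta>\<close> to \<open>\<beta>'\<close>, measured by the limiting Laplace transform \<open>limit_laplace\<close>. That
  transform is monotone in \<open>\<beta>\<close> with values in \<open>[0, 1]\<close>, so for almost every \<open>\<beta>\<close> its left difference
  quotients are bounded along a sequence of steps \<open>h\<close> tending to \<open>0\<close>
  (\<open>AE_bounded_left_difference_quotient\<close>). Then the loss is \<open>O(h)\<close>, and a deviation \<open>r\<close> that is a suitable
  multiple of \<open>h\<close> costs at least a constant times \<open>r\<^sup>2\<close>.
\<close>

section \<open>The four functions theorem\<close>

text \<open>
  The two mixed products must be controlled together: with \<open>X = c1 * d0\<close> both lie below \<open>X\<close>, and
  their product lies below \<open>X * (c0 * d1)\<close>; if \<open>X > 0\<close>, expanding
  \<open>(X - a0 * b1) * (X - a1 * b0) \<ge> 0\<close> and dividing by \<open>X\<close> bounds their sum by \<open>X + c0 * d1\<close>.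
\<close>
lemma two_point_four_functions:
  fixes a0 a1 b0 b1 c0 c1 d0 d1 :: real
  assumes "a0 \<ge> 0" "a1 \<ge> 0" "b0 \<ge> 0" "b1 \<ge> 0" "c0 \<ge> 0" "c1 \<ge> 0" "d0 \<ge> 0" "d1 \<ge> 0"
    and h00: "a0 * b0 \<le> c0 * d0" and h01: "a0 * b1 \<le> c1 * d0"
    and h10: "a1 * b0 \<le> c1 * d0" and h11: "a1 * b1 \<le> c1 * d1"
  shows "(a0 + a1) * (b0 + b1) \<le> (c0 + c1) * (d0 + d1)"
proof -
  define X where "X = c1 * d0"
  have "a0 * b1 + a1 * b0 \<le> X + c0 * d1"
  proof (cases "X = 0")
    case True
    then have "a0 * b1 \<le> 0" "a1 * b0 \<le> 0"
      using h01 h10 by (auto simp: X_def)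
    moreover have "0 \<le> c0 * d1"
      using assms by simp
    ultimately show ?thesis
      using True by simp
  next
    case False
    then have X: "X > 0"
      using assms by (simp add: X_def less_le)
    have "0 \<le> (X - a0 * b1) * (X - a1 * b0)"
      using h01 h10 by (simp add: X_def)
    moreover have "(a0 * b0) * (a1 * b1) \<le> (c0 * d0) * (c1 * d1)"
      using assms by (intro mult_mono[OF h00 h11]) auto
    ultimately have "X * (a0 * b1 + a1 * b0) \<le> X * (X + c0 * d1)"
      by (simp add: X_def algebra_simps)
    then show ?thesis
      using X by simp
  qed
  then show ?thesis
    using h00 h11 by (simp add: X_def algebra_simps)
qed

lemma sum_Pow_insert:
  assumes "finite E" "x \<notin> E"
  shows "(\<Sum>A\<in>Pow (insert x E). f A) = (\<Sum>A\<in>Pow E. f A + f (insert x A :: 'a set) :: real)"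
proof -
  have "inj_on (insert x) (Pow E)"
    using assms by (auto simp: inj_on_def)
  then have "(\<Sum>A\<in>insert x ` Pow E. f A) = (\<Sum>A\<in>Pow E. f (insert x A))"
    by (simp add: sum.reindex)
  moreover have "Pow E \<inter> insert x ` Pow E = {}"
    using assms by auto
  ultimately show ?thesis
    using assms by (simp add: Pow_insert sum.union_disjoint sum.distrib)
qed

text \<open>
  The theorem of Ahlswede and Daykin. Summing each function over the two states of one element
  preserves the hypothesis, by the two-point inequality, so the elements can be removed one by one.
\<close>
lemma four_functions:
  fixes \<alpha> \<beta> \<gamma> \<delta> :: "'a set \<Rightarrow> real"
  assumes "finite E"
    and "\<And>A. A \<subseteq> E \<Longrightarrow> \<alpha> A \<ge> 0 \<and> \<beta> A \<ge> 0 \<and> \<gamma> A \<ge> 0 \<and> \<delta> A \<ge> 0"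
    and "\<And>A B. A \<subseteq> E \<Longrightarrow> B \<subseteq> E \<Longrightarrow> \<alpha> A * \<beta> B \<le> \<gamma> (A \<union> B) * \<delta> (A \<inter> B)"
  shows "(\<Sum>A\<in>Pow E. \<alpha> A) * (\<Sum>A\<in>Pow E. \<beta> A) \<le> (\<Sum>A\<in>Pow E. \<gamma> A) * (\<Sum>A\<in>Pow E. \<delta> A)"
  using assms
proof (induction E arbitrary: \<alpha> \<beta> \<gamma> \<delta> rule: finite_induct)
  case empty
  from empty(2)[of "{}" "{}"] show ?case
    by simp
next
  case (insert x E)
  define sp where "sp f A = f A + f (insert x A)" for f :: "'a set \<Rightarrow> real" and A
  have nonneg: "\<alpha> A \<ge> 0 \<and> \<beta> A \<ge> 0 \<and> \<gamma> A \<ge> 0 \<and> \<delta> A \<ge> 0" if "A \<subseteq> insert x E" for A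
    using insert.prems(1) that by blast
  have "(\<Sum>A\<in>Pow E. sp \<alpha> A) * (\<Sum>A\<in>Pow E. sp \<beta> A) \<le> (\<Sum>A\<in>Pow E. sp \<gamma> A) * (\<Sum>A\<in>Pow E. sp \<delta> A)"
  proof (rule insert.IH)
    fix A assume "A \<subseteq> E"
    then show "sp \<alpha> A \<ge> 0 \<and> sp \<beta> A \<ge> 0 \<and> sp \<gamma> A \<ge> 0 \<and> sp \<delta> A \<ge> 0"
      using nonneg[of A] nonneg[of "insert x A"] by (auto simp: sp_def subset_insertI2 intro!: add_nonneg_nonneg)
  next
    fix A B assume AB: "A \<subseteq> E" "B \<subseteq> E"
    then have x: "x \<notin> A" "x \<notin> B"
      using insert.hyps by auto
    have sub: "A \<subseteq> insert x E" "insert x A \<subseteq> insert x E" "B \<subseteq> insert x E" "insert x B \<subseteq> insert x E"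
      "A \<union> B \<subseteq> insert x E" "insert x (A \<union> B) \<subseteq> insert x E"
      "A \<inter> B \<subseteq> insert x E" "insert x (A \<inter> B) \<subseteq> insert x E"
      using AB by auto
    have sets: "A \<inter> insert x B = A \<inter> B" "insert x A \<inter> B = A \<inter> B"
        "insert x A \<inter> insert x B = insert x (A \<inter> B)"
        "insert x A \<union> insert x B = insert x (A \<union> B)"
      using x by auto
    show "sp \<alpha> A * sp \<beta> B \<le> sp \<gamma> (A \<union> B) * sp \<delta> (A \<inter> B)"
      unfolding sp_def
    proof (rule two_point_four_functions)
      show "\<alpha> A * \<beta> B \<le> \<gamma> (A \<union> B) * \<delta> (A \<inter> B)"
        by (rule insert.prems(2)) (use sub in auto)
      show "\<alpha> A * \<beta> (insert x B) \<le> \<gamma> (insert x (A \<union> B)) * \<delta> (A \<inter> B)"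
        using insert.prems(2)[OF sub(1) sub(4)] by (simp add: sets)
      show "\<alpha> (insert x A) * \<beta> B \<le> \<gamma> (insert x (A \<union> B)) * \<delta> (A \<inter> B)"
        using insert.prems(2)[OF sub(2) sub(3)] by (simp add: sets)
      show "\<alpha> (insert x A) * \<beta> (insert x B) \<le> \<gamma> (insert x (A \<union> B)) * \<delta> (insert x (A \<inter> B))"
        using insert.prems(2)[OF sub(2) sub(4)] by (simp add: sets)
    qed (use nonneg sub in auto)
  qed
  then show ?case
    using insert.hyps by (simp add: sum_Pow_insert sp_def)
qed

section \<open>Supermodularity of the number of clusters\<close>

text \<open>
  Adding the elements of \<open>B - A\<close> one at a time, first to \<open>A \<inter> B\<close> and then to \<open>A\<close>, compares the two
  total increments term by term.
\<close>
lemma supermodular_if_local: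
  fixes f :: "'a set \<Rightarrow> int"
  assumes loc: "\<And>A B e. A \<subseteq> B \<Longrightarrow> B \<subseteq> E \<Longrightarrow> e \<in> E \<Longrightarrow> f B + f (insert e A) \<le> f (insert e B) + f A"
    and "A \<subseteq> E" "B \<subseteq> E" "finite E"
  shows "f A + f B \<le> f (A \<union> B) + f (A \<inter> B)"
proof -
  have "finite X \<Longrightarrow> X \<subseteq> B \<Longrightarrow> f A + f (A \<inter> B \<union> X) \<le> f (A \<union> X) + f (A \<inter> B)" for X
  proof (induction X rule: finite_induct)
    case (insert e X)
    have "f (A \<union> X) + f (insert e (A \<inter> B \<union> X)) \<le> f (insert e (A \<union> X)) + f (A \<inter> B \<union> X)"
      using assms(2,3) insert.prems by (intro loc) auto
    then show ?case
      using insert by simp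
  qed simp
  from this[of B] show ?thesis
    using finite_subset[OF assms(3,4)] by (simp add: Un_absorb1)
qed

lemma connected_by_refl [simp]: "connected_by \<omega> x x"
  by (simp add: connected_by_def)

lemma connected_by_trans: "connected_by \<omega> x y \<Longrightarrow> connected_by \<omega> y z \<Longrightarrow> connected_by \<omega> x z"
  unfolding connected_by_def by (rule rtrancl_trans)

lemma connected_by_sym: "connected_by \<omega> x y \<Longrightarrow> connected_by \<omega> y x"
proof -
  have "sym {(a, b). {a, b} \<in> \<omega>}"
    by (auto simp: sym_def insert_commute)
  then have "sym ({(a, b). {a, b} \<in> \<omega>}\<^sup>*)"
    by (rule sym_rtrancl)
  then show "connected_by \<omega> x y \<Longrightarrow> connected_by \<omega> y x"
    by (auto simp: connected_by_def dest: symD)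
qed

lemma connected_by_mono: "\<omega> \<subseteq> \<omega>' \<Longrightarrow> connected_by \<omega> x y \<Longrightarrow> connected_by \<omega>' x y"
  unfolding connected_by_def by (rule subsetD[OF rtrancl_mono]) auto

lemma connected_by_edge: "{x, y} \<in> \<omega> \<Longrightarrow> connected_by \<omega> x y"
  unfolding connected_by_def by auto

lemma connected_by_empty: "connected_by {} x y \<longleftrightarrow> x = y"
  by (auto simp: connected_by_def)

lemma connected_by_insert:
  "connected_by (insert {u, v} \<omega>) x y \<longleftrightarrow>
     connected_by \<omega> x y \<or> connected_by \<omega> x u \<and> connected_by \<omega> v y
       \<or> connected_by \<omega> x v \<and> connected_by \<omega> u y" (is "?l \<longleftrightarrow> ?r x y")
proof
  assume ?l
  then have "(x, y) \<in> {(a, b). {a, b} \<in> insert {u, v} \<omega>}\<^sup>*"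
    by (simp add: connected_by_def)
  then show "?r x y"
  proof (induction rule: rtrancl_induct)
    case (step y z)
    then consider "{y, z} \<in> \<omega>" | "y = u" "z = v" | "y = v" "z = u"
      by (auto simp: doubleton_eq_iff)
    then show ?case
    proof cases
      case 1
      then have "connected_by \<omega> y z"
        by (rule connected_by_edge)
      then show ?thesis
        using step.IH connected_by_trans[of \<omega> _ y z] by blast
    qed (use step.IH in auto)
  qed simp
next
  have m: "connected_by (insert {u, v} \<omega>) a b" if "connected_by \<omega> a b" for a b
    using that connected_by_mono by blast
  have e: "connected_by (insert {u, v} \<omega>) u v"
    by (intro connected_by_edge) simp
  note trans = connected_by_trans[of "insert {u, v} \<omega>"]
  assume "?r x y"
  then show ?l
  proof (elim disjE conjE)
    assume "connected_by \<omega> x u" "connected_by \<omega> v y"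
    then show ?l
      by (intro trans[OF m trans[OF e m]])
  next
    assume "connected_by \<omega> x v" "connected_by \<omega> u y"
    then show ?l
      by (intro trans[OF m trans[OF connected_by_sym[OF e] m]])
  qed (rule m)
qed

text \<open>
  The relation \<open>R'\<close> is the equivalence relation generated by \<open>R\<close> and the pair \<open>(u, v)\<close>: two classes
  are replaced by their union.
\<close>
lemma card_quotient_merge:
  assumes "finite V" "equiv V R" "u \<in> V" "v \<in> V" "(u, v) \<notin> R"
    and R': "R' = R \<union> (R `` {u}) \<times> (R `` {v}) \<union> (R `` {v}) \<times> (R `` {u})"
  shows "card (V // R') + 1 = card (V // R)"
proof -
  let ?U = "R `` {u}" and ?W = "R `` {v}"
  have "refl_on V R" "sym R" "trans R"
    using assms(2) by (auto elim: equivE)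
  then have reflR: "\<And>a. a \<in> V \<Longrightarrow> (a, a) \<in> R"
    and symR: "\<And>a b. (a, b) \<in> R \<Longrightarrow> (b, a) \<in> R"
    and transR: "\<And>a b c. (a, b) \<in> R \<Longrightarrow> (b, c) \<in> R \<Longrightarrow> (a, c) \<in> R"
    by (blast dest: refl_onD symD transD)+
  have class': "R' `` {x} = (if x \<in> ?U \<union> ?W then ?U \<union> ?W else R `` {x})" for x
  proof -
    have "x \<in> ?U \<Longrightarrow> R `` {x} = ?U" "x \<in> ?W \<Longrightarrow> R `` {x} = ?W"
      using equiv_class_eq[OF assms(2), of u x] equiv_class_eq[OF assms(2), of v x] by auto
    moreover have "R' `` {x} = R `` {x} \<union> (if x \<in> ?U then ?W else {}) \<union> (if x \<in> ?W then ?U else {})"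
      unfolding R' by (simp add: set_eq_iff) 
    ultimately show ?thesis
      by auto
  qed
  have old: "?U \<in> V // R" "?W \<in> V // R"
    using assms(3,4) by (simp_all add: quotientI)
  have ne: "?U \<noteq> ?W"
    using assms reflR by blast
  have fin: "finite (V // R)"
    using assms(1,2) by (simp add: finite_quotient[OF assms(1)] equiv_type)
  have new: "?U \<union> ?W \<notin> V // R - {?U, ?W}"
  proof
    assume *: "?U \<union> ?W \<in> V // R - {?U, ?W}"
    then have "?U \<union> ?W \<in> V // R"
      by simp
    then obtain x where "x \<in> V" "?U \<union> ?W = R `` {x}"
      by (rule quotientE)
    then have "(x, u) \<in> R" "(x, v) \<in> R"
      using reflR[OF assms(3)] reflR[OF assms(4)] by auto
    then show False
      using symR[of x u] transR[of u x v] assms(5) by simp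
  qed
  have "V // R' = insert (?U \<union> ?W) (V // R - {?U, ?W})"
  proof (intro equalityI subsetI)
    fix X assume "X \<in> V // R'"
    then obtain x where x: "x \<in> V" "X = R' `` {x}"
      by (rule quotientE)
    show "X \<in> insert (?U \<union> ?W) (V // R - {?U, ?W})"
    proof (cases "x \<in> ?U \<union> ?W")
      case True
      then show ?thesis
        unfolding x(2) class' by simp
    next
      case False
      then have "R `` {x} \<noteq> ?U" "R `` {x} \<noteq> ?W"
        using reflR[OF x(1)] by auto
      then show ?thesis
        unfolding x(2) class' using x(1) False by (simp add: quotientI)
    qed
  next
    fix X assume "X \<in> insert (?U \<union> ?W) (V // R - {?U, ?W})"
    then consider "X = ?U \<union> ?W" | "X \<in> V // R" "X \<noteq> ?U" "X \<noteq> ?W"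
      by auto
    then show "X \<in> V // R'"
    proof cases
      case 1
      then have "X = R' `` {u}"
        using class'[of u] reflR[OF assms(3)] by simp
      then show ?thesis
        using assms(3) by (simp add: quotientI)
    next
      case 2
      from 2(1) obtain x where x: "x \<in> V" "X = R `` {x}"
        by (rule quotientE)
      have "x \<notin> ?U \<union> ?W"
        using 2(2,3) x equiv_class_eq[OF assms(2), of u x] equiv_class_eq[OF assms(2), of v x] by auto
      then have "X = R' `` {x}"
        unfolding x(2) class' by simp
      then show ?thesis
        using x by (simp add: quotientI)
    qed
  qed
  then have "card (V // R') = Suc (card (V // R - {?U, ?W}))"
    using new fin by simp
  moreover have "card (V // R - {?U, ?W}) + 2 = card (V // R)"
  proof -
    have "card (V // R - {?U, ?W}) = card (V // R) - card {?U, ?W}"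
      using old by (intro card_Diff_subset) auto
    moreover have "card {?U, ?W} \<le> card (V // R)"
      using old fin by (intro card_mono) auto
    ultimately show ?thesis
      using ne by simp
  qed
  ultimately show ?thesis
    by simp
qed

lemma cluster_count_insert:
  assumes "finite (\<Union>E)" "{u, v} \<in> E"
  shows "cluster_count E \<pi> (insert {u, v} \<omega>) + (if connected_by (\<omega> \<union> \<pi>) u v then 0 else 1)
           = cluster_count E \<pi> \<omega>"
proof -
  let ?V = "\<Union>E"
  define R where "R = {(x, y). x \<in> ?V \<and> y \<in> ?V \<and> connected_by (\<omega> \<union> \<pi>) x y}"
  define R' where "R' = {(x, y). x \<in> ?V \<and> y \<in> ?V \<and> connected_by (insert {u, v} \<omega> \<union> \<pi>) x y}"
  have V: "u \<in> ?V" "v \<in> ?V"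
    using assms by auto
  have eq: "connected_by (insert {u, v} \<omega> \<union> \<pi>) x y \<longleftrightarrow>
      connected_by (\<omega> \<union> \<pi>) x y \<or> connected_by (\<omega> \<union> \<pi>) x u \<and> connected_by (\<omega> \<union> \<pi>) v y
       \<or> connected_by (\<omega> \<union> \<pi>) x v \<and> connected_by (\<omega> \<union> \<pi>) u y" for x y
    using connected_by_insert[of u v "\<omega> \<union> \<pi>"] by simp
  show ?thesis
  proof (cases "connected_by (\<omega> \<union> \<pi>) u v")
    case True
    then have "connected_by (insert {u, v} \<omega> \<union> \<pi>) x y \<longleftrightarrow> connected_by (\<omega> \<union> \<pi>) x y" for x y
      unfolding eq by (metis connected_by_trans connected_by_sym)
    then have "R' = R"
      unfolding R_def R'_def by simp
    then show ?thesis
      using True by (simp add: cluster_count_def R_def R'_def)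
  next
    case False
    have "card (?V // R') + 1 = card (?V // R)"
    proof (rule card_quotient_merge[OF assms(1) _ V])
      show "equiv ?V R"
        unfolding R_def
        by (intro equivI refl_onI symI transI)
          (auto intro: connected_by_trans connected_by_sym)
      show "(u, v) \<notin> R"
        using False by (simp add: R_def)
      show "R' = R \<union> R `` {u} \<times> R `` {v} \<union> R `` {v} \<times> R `` {u}"
        unfolding R_def R'_def eq using V
        by (auto intro: connected_by_sym)
    qed
    then show ?thesis
      using False by (simp add: cluster_count_def R_def R'_def)
  qed
qed

lemma cluster_count_insert_le:
  assumes "finite (\<Union>E)" "{u, v} \<in> E"
  shows "cluster_count E \<pi> (insert {u, v} \<omega>) \<le> cluster_count E \<pi> \<omega>"
  using cluster_count_insert[OF assms, of \<pi> \<omega>] by simp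

text \<open>
  Opening an edge removes a cluster exactly when its endpoints were not yet connected, which is less
  likely to happen once more edges are open.
\<close>
lemma cluster_count_supermodular:
  fixes E :: "(int ^ 'd) set set"
  assumes "finite E" "finite (\<Union>E)" and E: "\<And>e. e \<in> E \<Longrightarrow> \<exists>u v. e = {u, v}"
    and "A \<subseteq> E" "B \<subseteq> E"
  shows "cluster_count E \<pi> A + cluster_count E \<pi> B
           \<le> cluster_count E \<pi> (A \<union> B) + cluster_count E \<pi> (A \<inter> B)"
proof -
  have "int (cluster_count E \<pi> A) + int (cluster_count E \<pi> B)
      \<le> int (cluster_count E \<pi> (A \<union> B)) + int (cluster_count E \<pi> (A \<inter> B))"
  proof (rule supermodular_if_local[OF _ assms(4,5,1)])
    fix A B :: "(int ^ 'd) set set" and e assume AB: "A \<subseteq> B" and "e \<in> E"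
    then obtain u v where e: "e = {u, v}" "{u, v} \<in> E"
      using E by blast
    have "connected_by (A \<union> \<pi>) u v \<Longrightarrow> connected_by (B \<union> \<pi>) u v"
      using AB connected_by_mono[of "A \<union> \<pi>" "B \<union> \<pi>"] by blast
    then show "int (cluster_count E \<pi> B) + int (cluster_count E \<pi> (insert e A))
        \<le> int (cluster_count E \<pi> (insert e B)) + int (cluster_count E \<pi> A)"
      using cluster_count_insert[OF assms(2) e(2), of \<pi> A]
        cluster_count_insert[OF assms(2) e(2), of \<pi> B] unfolding e(1)
      by (simp split: if_splits)
  qed
  then show ?thesis
    by linarith
qed

section \<open>Raising the exponent in one coordinate\<close>
lemma bernoulli_powr:
  fixes x p :: real
  assumes "x \<ge> 0" "p \<ge> 1"
  shows "1 + p * (x - 1) \<le> x powr p"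
proof (cases "x = 0")
  case False
  then have x: "x > 0"
    using assms by simp
  have "convex_on {0<..} (\<lambda>x::real. x powr p)"
    using assms(2) by (intro powr_convex[THEN convex_on_subset]) auto
  then have "p * (x - 1) \<le> x powr p - 1 powr p"
  proof (rule convex_on_imp_above_tangent)
    show "((\<lambda>x. x powr p) has_real_derivative p) (at 1 within {0<..})"
      by (auto intro!: derivative_eq_intros)
  qed (use x in \<open>auto intro: convex_connected simp: interior_open\<close>)
  then show ?thesis
    by simp
qed (use assms in simp)

lemma exp_minus_le_quadratic:
  fixes x :: real
  assumes "x \<ge> 0"
  shows "exp (- x) \<le> 1 - x + x\<^sup>2 / 2"
proof -
  have "1 \<le> (1 - x + x\<^sup>2 / 2) * (1 + x + x\<^sup>2 / 2)"
    using zero_le_power2[of "x\<^sup>2"] by (simp add: algebra_simps power2_eq_square)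
  also have "\<dots> \<le> (1 - x + x\<^sup>2 / 2) * exp x"
  proof (intro mult_left_mono exp_lower_Taylor_quadratic assms)
    have "0 \<le> (1 - x)\<^sup>2 + 1"
      by simp
    then show "0 \<le> 1 - x + x\<^sup>2 / 2"
      by (simp add: power2_eq_square algebra_simps)
  qed
  finally show ?thesis
    by (simp add: exp_minus field_simps)
qed

text \<open>
  The second-order loss in \<open>exp (- p * x) \<le> 1 - p * x + (p * x)\<^sup>2 / 2\<close> is at most the fraction \<open>\<theta>\<close>
  of the linear term as long as \<open>p * x \<le> 2 * \<theta>\<close>. This is where the quadratic order of the final
  bound originates.
\<close>
lemma one_minus_powr_le:
  fixes x p b \<theta> :: real
  assumes "0 \<le> x" "x \<le> 1" "x \<le> b" "p \<ge> 1" "p * b \<le> 2 * \<theta>"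
  shows "(1 - x) powr p \<le> 1 - p * (1 - \<theta>) * x"
proof (cases "x = 1")
  case True
  then have "p \<le> 2 * \<theta>"
    using assms mult_left_mono[of 1 b p] by linarith
  moreover have "0 \<le> (p - 1)\<^sup>2 + 1"
    by simp
  then have "2 * p \<le> p * p + 2"
    by (simp add: power2_eq_square algebra_simps)
  moreover have "p * p \<le> p * (2 * \<theta>)"
    using calculation(1) assms(4) by (intro mult_left_mono) auto
  ultimately have "p - p * \<theta> \<le> 1"
    by linarith
  then show ?thesis
    using True by (simp add: algebra_simps)
next
  case False
  then have "(1 - x) powr p = exp (p * ln (1 - x))"
    using assms by (simp add: powr_def)
  also have "\<dots> \<le> exp (- (p * x))"
    using mult_left_mono[of "ln (1 - x)" "- x" p] ln_le_minus_one[of "1 - x"] False assms by simp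
  also have "\<dots> \<le> 1 - p * x + (p * x)\<^sup>2 / 2"
    using assms by (intro exp_minus_le_quadratic) simp
  also have "(p * x)\<^sup>2 \<le> (p * b) * (p * x)"
    using assms by (simp add: power2_eq_square mult_mono)
  also have "\<dots> \<le> (2 * \<theta>) * (p * x)"
    using assms by (intro mult_right_mono) auto
  finally show ?thesis
    by (simp add: algebra_simps)
qed

locale unit_interval_law = prob_space \<mu> for \<mu> :: "real measure" +
  assumes sets_law: "sets \<mu> = sets (restrict_space borel {0..1})"
begin

lemma space_law: "space \<mu> = {0..1}"
  using sets_eq_imp_space_eq[OF sets_law] by (simp add: space_restrict_space)

lemma measurable_scale_law [measurable]:
  assumes "s \<in> {0..1}"
  shows "(\<lambda>t. s * t) \<in> measurable \<mu> \<mu>"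
proof -
  have "(\<lambda>t. s * t) \<in> measurable (restrict_space borel {0..1}) (restrict_space borel {0..1})"
    using assms by (intro measurable_restrict_space3) (auto intro: mult_le_one)
  then show ?thesis
    using measurable_cong_sets[OF sets_law sets_law] by simp
qed

lemma measurable_id_law [measurable]: "(\<lambda>t. t) \<in> borel_measurable \<mu>"
  unfolding measurable_cong_sets[OF sets_law refl] by (simp add: measurable_restrict_space1)

text \<open>
  A one-dimensional reverse Jensen inequality, paid for by contracting the argument. After division by
  \<open>f 0\<close> write \<open>f = 1 - X\<close> with \<open>X\<close> in \<open>[0, b]\<close>. The numerical hypothesis linearizes the left side to
  \<open>1 - p * (1 - \<theta>) * E X\<close>, contraction says that \<open>(1 - \<theta>) * X t\<close> dominates \<open>X (s * t)\<close>, and the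
  Bernoulli inequality turns \<open>1 - p * E X (s * t)\<close> into the \<open>p\<close>-th power on the right.
\<close>
lemma integral_powr_le_powr_integral_scaled:
  fixes f :: "real \<Rightarrow> real"
  assumes meas [measurable]: "f \<in> borel_measurable \<mu>"
    and s: "s \<in> {0..1}" and "p \<ge> 1"
    and nonneg: "\<And>t. t \<in> {0..1} \<Longrightarrow> 0 \<le> f t"
    and upper: "\<And>t. t \<in> {0..1} \<Longrightarrow> f t \<le> f 0"
    and lower: "\<And>t. t \<in> {0..1} \<Longrightarrow> (1 - b) * f 0 \<le> f t"
    and contract: "\<And>t. t \<in> {0..1} \<Longrightarrow> f 0 - f (s * t) \<le> (1 - \<theta>) * (f 0 - f t)"
    and num: "\<And>x. 0 \<le> x \<Longrightarrow> x \<le> 1 \<Longrightarrow> x \<le> b \<Longrightarrow> (1 - x) powr p \<le> 1 - p * (1 - \<theta>) * x"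
  shows "(\<integral>t. f t powr p \<partial>\<mu>) \<le> (\<integral>t. f (s * t) \<partial>\<mu>) powr p"
proof (cases "f 0 = 0")
  case True
  then have "\<And>t. t \<in> {0..1} \<Longrightarrow> f t = 0"
    using nonneg upper by force
  then have "(\<integral>t. f t powr p \<partial>\<mu>) = (\<integral>t. 0 \<partial>\<mu>)"
    by (intro Bochner_Integration.integral_cong) (auto simp: space_law)
  then show ?thesis
    by simp
next
  case False
  then have f0: "f 0 > 0"
    using nonneg[of 0] by simp
  define X where "X t = 1 - f t / f 0" for t
  have st: "s * t \<in> {0..1}" if "t \<in> {0..1}" for t
    using s that by (auto intro: mult_le_one)
  have X: "0 \<le> X t" "X t \<le> 1" "X t \<le> b" "X (s * t) \<le> (1 - \<theta>) * X t" if "t \<in> {0..1}" for t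
  proof -
    show "0 \<le> X t" "X t \<le> 1"
      using nonneg[OF that] upper[OF that] f0 by (auto simp: X_def)
    show "X t \<le> b"
      using lower[OF that] f0 by (simp add: X_def field_simps)
    have "X (s * t) = (f 0 - f (s * t)) / f 0" "X t = (f 0 - f t) / f 0"
      using f0 by (auto simp: X_def field_simps)
    then show "X (s * t) \<le> (1 - \<theta>) * X t"
      using divide_right_mono[OF contract[OF that], of "f 0"] f0 by simp
  qed
  have [measurable]: "X \<in> borel_measurable \<mu>"
    unfolding X_def by measurable
  have intX: "integrable \<mu> X"
    by (intro integrable_const_bound[where B=1]) (auto simp: space_law X intro!: AE_I2)
  have [measurable]: "(\<lambda>t. X (s * t)) \<in> borel_measurable \<mu>"
    using measurable_compose[OF measurable_scale_law[OF s] \<open>X \<in> borel_measurable \<mu>\<close>] .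
  have intX': "integrable \<mu> (\<lambda>t. X (s * t))"
    using X st by (intro integrable_const_bound[where B=1]) (auto simp: space_law intro!: AE_I2)
  have "(\<integral>t. (1 - X t) powr p \<partial>\<mu>) \<le> (\<integral>t. 1 - p * (1 - \<theta>) * X t \<partial>\<mu>)"
  proof (rule integral_mono)
    show "integrable \<mu> (\<lambda>t. (1 - X t) powr p)"
      using X \<open>p \<ge> 1\<close> by (intro integrable_const_bound[where B=1])
        (auto simp: space_law intro!: AE_I2 powr_le1)
  qed (use intX X in \<open>auto simp: space_law intro!: num\<close>)
  also have "\<dots> = 1 - p * (\<integral>t. (1 - \<theta>) * X t \<partial>\<mu>)"
    using intX by (simp add: prob_space)
  also have "\<dots> \<le> 1 - p * (\<integral>t. X (s * t) \<partial>\<mu>)"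
    using X intX intX' \<open>p \<ge> 1\<close>
    by (intro diff_left_mono mult_left_mono integral_mono) (auto simp: space_law)
  also have "\<dots> = 1 + p * ((\<integral>t. 1 - X (s * t) \<partial>\<mu>) - 1)"
    using intX' by (simp add: prob_space algebra_simps)
  also have "\<dots> \<le> (\<integral>t. 1 - X (s * t) \<partial>\<mu>) powr p"
    using X st \<open>p \<ge> 1\<close> by (intro bernoulli_powr integral_nonneg_AE) (auto simp: space_law intro!: AE_I2)
  finally have *: "(\<integral>t. (1 - X t) powr p \<partial>\<mu>) \<le> (\<integral>t. 1 - X (s * t) \<partial>\<mu>) powr p" .
  have "(\<integral>t. f t powr p \<partial>\<mu>) = (\<integral>t. f 0 powr p * (1 - X t) powr p \<partial>\<mu>)"
    using f0 nonneg
    by (intro Bochner_Integration.integral_cong) (auto simp: space_law X_def powr_divide)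
  also have "\<dots> \<le> f 0 powr p * (\<integral>t. 1 - X (s * t) \<partial>\<mu>) powr p"
    using * by (simp add: mult_left_mono)
  also have "\<dots> = (f 0 * (\<integral>t. 1 - X (s * t) \<partial>\<mu>)) powr p"
    by (rule powr_mult[symmetric])
  also have "f 0 * (\<integral>t. 1 - X (s * t) \<partial>\<mu>) = (\<integral>t. f 0 * (1 - X (s * t)) \<partial>\<mu>)"
    by simp
  also have "\<dots> = (\<integral>t. f (s * t) \<partial>\<mu>)"
    using f0 by (simp add: X_def)
  finally show ?thesis .
qed

section \<open>Raising the exponent in a product space\<close>

text \<open>
  The hypotheses of the one-dimensional inequality, imposed in every coordinate. They are linear in
  \<open>u\<close>, hence survive averaging over some of the coordinates, with the same constants; this is what
  makes the inequality tensorize without any loss in the number of coordinates.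
\<close>
definition contracting :: "'i set \<Rightarrow> real \<Rightarrow> real \<Rightarrow> real \<Rightarrow> (('i \<Rightarrow> real) \<Rightarrow> real) \<Rightarrow> bool" where
  "contracting I s \<theta> b u \<longleftrightarrow>
     u \<in> borel_measurable (PiM I (\<lambda>_. \<mu>)) \<and>
     (\<forall>a\<in>PiE I (\<lambda>_. {0..1}). 0 \<le> u a \<and> u a \<le> 1 \<and>
       (\<forall>i\<in>I. \<forall>t\<in>{0..1}. u (a(i := t)) \<le> u (a(i := 0)) \<and> (1 - b) * u (a(i := 0)) \<le> u (a(i := t)) \<and>
         u (a(i := 0)) - u (a(i := s * t)) \<le> (1 - \<theta>) * (u (a(i := 0)) - u (a(i := t)))))"

lemma space_PiM_law: "space (PiM I (\<lambda>_. \<mu>)) = PiE I (\<lambda>_. {0..1})"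
  by (simp add: space_PiM space_law)

lemma measurable_scale_PiM [measurable]:
  assumes "s \<in> {0..1}"
  shows "(\<lambda>a. \<lambda>i\<in>I. s * a i) \<in> measurable (PiM I (\<lambda>_. \<mu>)) (PiM I (\<lambda>_. \<mu>))"
  by (intro measurable_restrict measurable_compose[OF measurable_component_singleton]
      measurable_scale_law assms)

lemma prob_space_PiM_law: "prob_space (PiM I (\<lambda>_. \<mu>))"
  by (intro prob_space_PiM) unfold_locales

lemma contracting_integral_coordinate:
  assumes u: "contracting (insert i I) s \<theta> b u" and "i \<notin> I" and s: "s \<in> {0..1}"
  shows "contracting I s \<theta> b (\<lambda>a. \<integral>t. u (a(i := s * t)) \<partial>\<mu>)"
proof -
  note [measurable] = measurable_scale_law[OF s]
  let ?P = "PiM I (\<lambda>_. \<mu>)"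
  have [measurable]: "u \<in> borel_measurable (PiM (insert i I) (\<lambda>_. \<mu>))"
    using u by (simp add: contracting_def)
  have st: "s * t \<in> {0..1}" if "t \<in> {0..1}" for t
    using s that by (auto intro: mult_le_one)
  have ext: "a(i := s * t) \<in> PiE (insert i I) (\<lambda>_. {0..1})"
    if "a \<in> PiE I (\<lambda>_. {0..1})" "t \<in> {0..1}" for a t
    using st[OF that(2)] that(1) by (intro PiE_fun_upd)
  have upd: "a(j := t) \<in> PiE I (\<lambda>_. {0..1})"
    if "a \<in> PiE I (\<lambda>_. {0..1})" "j \<in> I" "t \<in> {0..1}" for a j t
    using that by (auto simp: PiE_iff extensional_def)
  have bounds: "0 \<le> u (a(i := s * t))" "u (a(i := s * t)) \<le> 1"
    if "a \<in> PiE I (\<lambda>_. {0..1})" "t \<in> {0..1}" for a t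
    using u ext[OF that] by (auto simp: contracting_def)
  have reg: "u (a(i := s * y, j := t)) \<le> u (a(i := s * y, j := 0))"
      "(1 - b) * u (a(i := s * y, j := 0)) \<le> u (a(i := s * y, j := t))"
      "u (a(i := s * y, j := 0)) - u (a(i := s * y, j := s * t))
        \<le> (1 - \<theta>) * (u (a(i := s * y, j := 0)) - u (a(i := s * y, j := t)))"
    if "a \<in> PiE I (\<lambda>_. {0..1})" "j \<in> I" "t \<in> {0..1}" "y \<in> {0..1}" for a j t y
    using u ext[OF that(1,4)] that(2,3) unfolding contracting_def by blast+
  have [measurable]: "(\<lambda>t. u (a(i := s * t))) \<in> borel_measurable \<mu>"
    if "a \<in> PiE I (\<lambda>_. {0..1})" for a
  proof -
    have "(\<lambda>t. a(i := s * t)) \<in> measurable \<mu> (PiM (insert i I) (\<lambda>_. \<mu>))"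
      using that by (intro measurable_fun_upd[where J=I]) (auto simp: space_PiM_law)
    then show ?thesis
      by measurable
  qed
  have int: "integrable \<mu> (\<lambda>t. u (a(i := s * t)))" if "a \<in> PiE I (\<lambda>_. {0..1})" for a
    using that bounds[OF that]
    by (intro integrable_const_bound[where B=1]) (auto simp: space_law intro!: AE_I2)
  have "(\<lambda>a. \<integral>t. u (a(i := s * t)) \<partial>\<mu>) \<in> borel_measurable ?P"
  proof -
    have "(\<lambda>(a, t). a(i := s * t)) \<in> measurable (?P \<Otimes>\<^sub>M \<mu>) (PiM (insert i I) (\<lambda>_. \<mu>))"
      unfolding split_beta' by (intro measurable_fun_upd[where J=I]) auto
    then have "(\<lambda>(a, t). u (a(i := s * t))) \<in> borel_measurable (?P \<Otimes>\<^sub>M \<mu>)"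
      unfolding split_beta' by measurable
    then show ?thesis
      by (rule borel_measurable_lebesgue_integral)
  qed
  moreover have "0 \<le> (\<integral>t. u (a(i := s * t)) \<partial>\<mu>)" "(\<integral>t. u (a(i := s * t)) \<partial>\<mu>) \<le> 1"
    if a: "a \<in> PiE I (\<lambda>_. {0..1})" for a
  proof -
    show "0 \<le> (\<integral>t. u (a(i := s * t)) \<partial>\<mu>)"
      using bounds[OF a] by (intro integral_nonneg_AE) (auto simp: space_law intro!: AE_I2)
    show "(\<integral>t. u (a(i := s * t)) \<partial>\<mu>) \<le> 1"
      using bounds[OF a] by (intro integral_le_const int a) (auto simp: space_law intro!: AE_I2)
  qed
  moreover have "(\<integral>y. u (a(j := t, i := s * y)) \<partial>\<mu>) \<le> (\<integral>y. u (a(j := 0, i := s * y)) \<partial>\<mu>) \<and>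
      (1 - b) * (\<integral>y. u (a(j := 0, i := s * y)) \<partial>\<mu>) \<le> (\<integral>y. u (a(j := t, i := s * y)) \<partial>\<mu>) \<and>
      (\<integral>y. u (a(j := 0, i := s * y)) \<partial>\<mu>) - (\<integral>y. u (a(j := s * t, i := s * y)) \<partial>\<mu>)
        \<le> (1 - \<theta>) * ((\<integral>y. u (a(j := 0, i := s * y)) \<partial>\<mu>) - (\<integral>y. u (a(j := t, i := s * y)) \<partial>\<mu>))"
    if a: "a \<in> PiE I (\<lambda>_. {0..1})" and j: "j \<in> I" and t: "t \<in> {0..1}" for a j t
  proof -
    have "i \<noteq> j"
      using j \<open>i \<notin> I\<close> by auto
    note comm = fun_upd_twist[OF this, symmetric]
    have i: "integrable \<mu> (\<lambda>y. u (a(j := t, i := s * y)))"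
        "integrable \<mu> (\<lambda>y. u (a(j := 0, i := s * y)))"
        "integrable \<mu> (\<lambda>y. u (a(j := s * t, i := s * y)))"
      using int upd[OF a j] t st[OF t] by auto
    have "(\<integral>y. u (a(j := t, i := s * y)) \<partial>\<mu>) \<le> (\<integral>y. u (a(j := 0, i := s * y)) \<partial>\<mu>)"
      by (intro integral_mono i) (use reg(1)[OF a j t] in \<open>simp add: space_law comm\<close>)
    moreover have "(\<integral>y. (1 - b) * u (a(j := 0, i := s * y)) \<partial>\<mu>) \<le> (\<integral>y. u (a(j := t, i := s * y)) \<partial>\<mu>)"
      by (intro integral_mono integrable_mult_right i)
        (use reg(2)[OF a j t] in \<open>simp add: space_law comm\<close>)
    moreover have "(\<integral>y. u (a(j := 0, i := s * y)) - u (a(j := s * t, i := s * y)) \<partial>\<mu>)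
       \<le> (\<integral>y. (1 - \<theta>) * (u (a(j := 0, i := s * y)) - u (a(j := t, i := s * y))) \<partial>\<mu>)"
      by (intro integral_mono integrable_mult_right Bochner_Integration.integrable_diff i)
        (use reg(3)[OF a j t] in \<open>simp add: space_law comm\<close>)
    ultimately show ?thesis
      using i by simp
  qed
  ultimately show ?thesis
    unfolding contracting_def by blast
qed

text \<open>
  By induction over the coordinates: the inequality in coordinate \<open>i\<close>, with the others frozen,
  replaces the inner integral of \<open>u\<close> to the power \<open>p\<close> by the \<open>p\<close>-th power of \<open>v\<close>, the average of \<open>u\<close>
  over the contracted coordinate \<open>i\<close>, and \<open>v\<close> is again contracting.
\<close>
theorem contracting_integral_powr_le:
  assumes "finite I" and u: "contracting I s \<theta> b u"
    and s: "s \<in> {0..1}" and p: "p \<ge> 1"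
    and num: "\<And>x. 0 \<le> x \<Longrightarrow> x \<le> 1 \<Longrightarrow> x \<le> b \<Longrightarrow> (1 - x) powr p \<le> 1 - p * (1 - \<theta>) * x"
  shows "(\<integral>a. u a powr p \<partial>PiM I (\<lambda>_. \<mu>)) \<le> (\<integral>a. u (\<lambda>i\<in>I. s * a i) \<partial>PiM I (\<lambda>_. \<mu>)) powr p"
  using assms(1) u
proof (induction I arbitrary: u rule: finite_induct)
  case empty
  then show ?case
    by (simp add: PiM_empty lebesgue_integral_count_space_finite restrict_def)
next
  case (insert i I)
  interpret product_sigma_finite "\<lambda>_. \<mu>"
    by unfold_locales
  interpret PI: prob_space "PiM I (\<lambda>_. \<mu>)"
    by (rule prob_space_PiM_law)
  interpret Pi: prob_space "PiM (insert i I) (\<lambda>_. \<mu>)"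
    by (rule prob_space_PiM_law)
  note u = insert.prems
  define v where "v a = (\<integral>t. u (a(i := s * t)) \<partial>\<mu>)" for a
  have v: "contracting I s \<theta> b v"
    unfolding v_def by (rule contracting_integral_coordinate[OF u insert.hyps(2) s])
  have st: "s * t \<in> {0..1}" if "t \<in> {0..1}" for t
    using s that by (auto intro: mult_le_one)
  have [measurable]: "u \<in> borel_measurable (PiM (insert i I) (\<lambda>_. \<mu>))" "v \<in> borel_measurable (PiM I (\<lambda>_. \<mu>))"
    using u v by (auto simp: contracting_def)
  have bounds: "0 \<le> u a" "u a \<le> 1" if "a \<in> PiE (insert i I) (\<lambda>_. {0..1})" for a
    using u that by (auto simp: contracting_def)
  have vbounds: "0 \<le> v a" "v a \<le> 1" if "a \<in> PiE I (\<lambda>_. {0..1})" for a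
    using v that by (auto simp: contracting_def)
  have ext: "a(i := t) \<in> PiE (insert i I) (\<lambda>_. {0..1})"
    if "a \<in> PiE I (\<lambda>_. {0..1})" "t \<in> {0..1}" for a t
    using that by (intro PiE_fun_upd)
  have one: "(\<integral>t. u (a(i := t)) powr p \<partial>\<mu>) \<le> v a powr p" if a: "a \<in> PiE I (\<lambda>_. {0..1})" for a
    unfolding v_def
  proof (rule integral_powr_le_powr_integral_scaled[OF _ s p _ _ _ _ num])
    have "(\<lambda>t. a(i := t)) \<in> measurable \<mu> (PiM (insert i I) (\<lambda>_. \<mu>))"
      using a by (intro measurable_fun_upd[where J=I]) (auto simp: space_PiM_law)
    then show "(\<lambda>t. u (a(i := t))) \<in> borel_measurable \<mu>"
      by measurable
    fix t :: real assume t: "t \<in> {0..1}"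
    have "a(i := t, i := y) = a(i := y)" for y
      by simp
    then show "0 \<le> u (a(i := t))" "u (a(i := t)) \<le> u (a(i := 0))"
        "(1 - b) * u (a(i := 0)) \<le> u (a(i := t))"
        "u (a(i := 0)) - u (a(i := s * t)) \<le> (1 - \<theta>) * (u (a(i := 0)) - u (a(i := t)))"
      using u ext[OF a t] t unfolding contracting_def by (metis insertI1)+
  qed
  have intv: "integrable (PiM I (\<lambda>_. \<mu>)) (\<lambda>a. v a powr p)"
    using vbounds p by (intro PI.integrable_const_bound[where B=1])
      (auto simp: space_PiM_law intro!: AE_I2 powr_le1)
  have intu: "integrable (PiM (insert i I) (\<lambda>_. \<mu>)) (\<lambda>a. u a powr p)"
    using bounds p by (intro Pi.integrable_const_bound[where B=1])
      (auto simp: space_PiM_law intro!: AE_I2 powr_le1)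
  have "(\<integral>a. u a powr p \<partial>PiM (insert i I) (\<lambda>_. \<mu>)) = (\<integral>a. \<integral>t. u (a(i := t)) powr p \<partial>\<mu> \<partial>PiM I (\<lambda>_. \<mu>))"
    by (rule product_integral_insert[OF insert.hyps intu])
  also have "\<dots> \<le> (\<integral>a. v a powr p \<partial>PiM I (\<lambda>_. \<mu>))"
    using one intv by (intro integral_mono_AE') (auto intro!: AE_I2 integral_nonneg_AE simp: space_PiM_law)
  also have "\<dots> \<le> (\<integral>a. v (\<lambda>j\<in>I. s * a j) \<partial>PiM I (\<lambda>_. \<mu>)) powr p"
    by (rule insert.IH[OF v])
  also have "(\<integral>a. v (\<lambda>j\<in>I. s * a j) \<partial>PiM I (\<lambda>_. \<mu>))
      = (\<integral>a. \<integral>t. u (\<lambda>j\<in>insert i I. s * (a(i := t)) j) \<partial>\<mu> \<partial>PiM I (\<lambda>_. \<mu>))"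
  proof -
    have "(\<lambda>j\<in>I. s * a j)(i := s * t) = (\<lambda>j\<in>insert i I. s * (a(i := t)) j)" for a t
      using insert.hyps by (auto simp: fun_eq_iff)
    then show ?thesis
      by (simp add: v_def)
  qed
  also have "\<dots> = (\<integral>a. u (\<lambda>j\<in>insert i I. s * a j) \<partial>PiM (insert i I) (\<lambda>_. \<mu>))"
  proof (rule product_integral_insert[OF insert.hyps, symmetric])
    note [measurable] = measurable_scale_PiM[OF s]
    have "(\<lambda>j\<in>insert i I. s * a j) \<in> PiE (insert i I) (\<lambda>_. {0..1})"
      if "a \<in> PiE (insert i I) (\<lambda>_. {0..1})" for a
      using that st by (auto simp: PiE_iff)
    then show "integrable (PiM (insert i I) (\<lambda>_. \<mu>)) (\<lambda>a. u (\<lambda>j\<in>insert i I. s * a j))"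
      using bounds by (intro Pi.integrable_const_bound[where B=1])
        (auto simp: space_PiM_law intro!: AE_I2)
  qed
  finally show ?case .
qed

end

section \<open>Dependence of a decreasing event on one edge\<close>

text \<open>
  As a function of the probability \<open>t\<close> that one edge is open, the probability of an event is a ratio
  of affine functions. With \<open>den t\<close> for the denominator, everything follows from
  \<open>f 0 - f t = t * (A' * B - B' * A) / (A * den t)\<close> and from \<open>den\<close> being decreasing.
\<close>
lemma mobius_ratio_bounds:
  fixes A A' B B' t :: real
  defines "f \<equiv> \<lambda>t. ((1 - t) * A' + t * B') / ((1 - t) * A + t * B)"
  assumes pos: "A > 0" "A' \<ge> 0" "B' \<ge> 0" "B \<ge> 0" "B \<le> A" "B' * A \<le> B * A'" and t: "0 \<le> t" "t < 1"
  shows "f t \<le> f 0" "(1 - t) * f 0 \<le> f t"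
    "\<And>t' \<theta>. 0 \<le> t' \<Longrightarrow> \<theta> \<in> {0..1} \<Longrightarrow> t' \<le> (1 - \<theta>) * t \<Longrightarrow> f 0 - f t' \<le> (1 - \<theta>) * (f 0 - f t)"
proof -
  define den where "den t = (1 - t) * A + t * B" for t
  define K where "K = A' * B - B' * A"
  have K: "K \<ge> 0"
    using pos by (simp add: K_def algebra_simps)
  have den: "den t > 0" if "0 \<le> t" "t < 1" for t
    unfolding den_def using that pos by (intro add_pos_nonneg) auto
  have den_anti: "den t \<le> den t'" if "t' \<le> t" for t t'
  proof -
    have "0 \<le> (t - t') * (A - B)"
      using that pos by simp
    then show ?thesis
      by (simp add: den_def algebra_simps)
  qed
  have f: "f t = ((1 - t) * A' + t * B') / den t" for t
    by (simp add: f_def den_def)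
  have diff: "f 0 - f t = t * K / (A * den t)" if "0 \<le> t" "t < 1" for t
    using den[OF that] den[of 0] pos unfolding f
    by (simp add: divide_simps den_def[of 0]) (simp add: den_def K_def algebra_simps)
  show "f t \<le> f 0"
    using diff[OF t] den[OF t] t K pos(1) by (smt (verit) divide_nonneg_pos mult_nonneg_nonneg mult_pos_pos)
  have "(1 - t) * f 0 = (1 - t) * A' / A"
    by (simp add: f den_def)
  also have "\<dots> \<le> (1 - t) * A' / den t"
    using den_anti[of 0 t] den[OF t] t pos by (intro divide_left_mono) (auto simp: den_def[of 0])
  also have "\<dots> \<le> f t"
    unfolding f using den[OF t] t pos by (intro divide_right_mono) auto
  finally show "(1 - t) * f 0 \<le> f t" .
  show "f 0 - f t' \<le> (1 - \<theta>) * (f 0 - f t)" if \<theta>: "0 \<le> t'" "\<theta> \<in> {0..1}" "t' \<le> (1 - \<theta>) * t" for t' \<theta>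
  proof -
    have "(1 - \<theta>) * t \<le> t"
      using \<theta> t by (intro mult_left_le_one_le) auto
    then have t': "t' \<le> t" "t' < 1"
      using \<theta> t by auto
    have "f 0 - f t' = t' * K / (A * den t')"
      using diff \<theta> t' by simp
    also have "\<dots> \<le> ((1 - \<theta>) * t) * K / (A * den t)"
      using \<theta> t t' K pos den[OF t] den_anti[OF t'(1)]
      by (intro frac_le mult_right_mono mult_left_mono mult_pos_pos mult_nonneg_nonneg) auto
    also have "\<dots> = (1 - \<theta>) * (f 0 - f t)"
      using diff[OF t] by simp
    finally show ?thesis .
  qed
qed

text \<open>
  Raising to a power \<open>r \<le> 1\<close> keeps the contraction because \<open>x powr r\<close> is concave: \<open>x'\<close> dominates the
  convex combination of \<open>x\<close> and \<open>x0\<close> with weights \<open>1 - \<theta>\<close> and \<open>\<theta>\<close>.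
\<close>
lemma contraction_powr:
  fixes x x' x0 \<theta> r :: real
  assumes "0 < x" "x \<le> x0" "0 \<le> x'" "\<theta> \<in> {0..1}" "x0 - x' \<le> (1 - \<theta>) * (x0 - x)" and r: "0 < r" "r \<le> 1"
  shows "x0 powr r - x' powr r \<le> (1 - \<theta>) * (x0 powr r - x powr r)"
proof -
  have "convex_on {0<..} (\<lambda>y::real. y powr (1 / r))"
    using r by (intro powr_convex) simp
  then have "((1 - \<theta>) *\<^sub>R (x powr r) + \<theta> *\<^sub>R (x0 powr r)) powr (1 / r)
      \<le> (1 - \<theta>) * (x powr r) powr (1 / r) + \<theta> * (x0 powr r) powr (1 / r)"
    by (rule convex_onD) (use assms in auto)
  also have "\<dots> = (1 - \<theta>) * x + \<theta> * x0"
    using assms by (simp add: powr_powr)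
  also have "\<dots> \<le> x'"
    using assms by (simp add: algebra_simps)
  finally have "(((1 - \<theta>) * x powr r + \<theta> * x0 powr r) powr (1 / r)) powr r \<le> x' powr r"
    using r by (intro powr_mono2) auto
  then have "(1 - \<theta>) * x powr r + \<theta> * x0 powr r \<le> x' powr r"
    using assms by (simp add: powr_powr)
  then show ?thesis
    by (simp add: algebra_simps)
qed

text \<open>
  Scaling the coupling by \<open>s\<close> contracts the probability of an open edge by a definite factor,
  uniformly in the coupling.
\<close>
lemma one_minus_exp_scaled_le:
  fixes \<beta> s t :: real
  assumes "\<beta> \<ge> 0" "s \<in> {0..1}" "t \<in> {0..1}"
  shows "1 - exp (- (\<beta> * (s * t))) \<le> (1 - (1 - s) * exp (- \<beta>)) * (1 - exp (- (\<beta> * t)))"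
proof -
  define a where "a = \<beta> * t"
  have a: "0 \<le> a" "a \<le> \<beta>"
    using assms by (auto simp: a_def intro: mult_left_le)
  have "(1 - s) * exp (- \<beta>) * (1 - exp (- a)) \<le> (1 - s) * exp (- a) * a"
    using assms a exp_ge_add_one_self[of "- a"]
    by (intro mult_mono) auto
  also have "\<dots> = exp (- a) * ((1 - s) * a)"
    by simp
  also have "\<dots> \<le> exp (- a) * (exp ((1 - s) * a) - 1)"
    using exp_ge_add_one_self[of "(1 - s) * a"] by (intro mult_left_mono) (linarith, simp)
  also have "\<dots> = exp (- (s * a)) - exp (- a)"
    by (simp add: right_diff_distrib exp_add[symmetric] algebra_simps)
  finally show ?thesis
    by (simp add: a_def algebra_simps)
qed

section \<open>Decreasing events under a positively associated weight\<close>
definition bernoulli_weight :: "'e set \<Rightarrow> ('e \<Rightarrow> real) \<Rightarrow> 'e set \<Rightarrow> real" where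
  "bernoulli_weight F p A = (\<Prod>e\<in>F. if e \<in> A then p e else 1 - p e)"

lemma bernoulli_weight_nonneg:
  "(\<And>e. e \<in> F \<Longrightarrow> 0 \<le> p e \<and> p e \<le> 1) \<Longrightarrow> 0 \<le> bernoulli_weight F p A"
  unfolding bernoulli_weight_def by (rule prod_nonneg) auto

lemma bernoulli_weight_empty_pos:
  "(\<And>e. e \<in> F \<Longrightarrow> p e < 1) \<Longrightarrow> 0 < bernoulli_weight F p {}"
  unfolding bernoulli_weight_def by (rule prod_pos) auto

lemma bernoulli_weight_union_inter:
  "bernoulli_weight F p A * bernoulli_weight F p B = bernoulli_weight F p (A \<union> B) * bernoulli_weight F p (A \<inter> B)"
  unfolding bernoulli_weight_def prod.distrib[symmetric] by (intro prod.cong) auto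

lemma bernoulli_weight_fun_upd:
  assumes "finite E" "e \<in> E"
  shows "bernoulli_weight E (p(e := t)) A
    = (if e \<in> A then t else 1 - t) * bernoulli_weight (E - {e}) p (A - {e})"
proof -
  have "bernoulli_weight E (p(e := t)) A
      = (if e \<in> A then t else 1 - t) * bernoulli_weight (E - {e}) (p(e := t)) A"
    unfolding bernoulli_weight_def
    using prod.remove[OF assms, of "\<lambda>f. if f \<in> A then (p(e := t)) f else 1 - (p(e := t)) f"] by simp
  also have "bernoulli_weight (E - {e}) (p(e := t)) A = bernoulli_weight (E - {e}) p (A - {e})"
    unfolding bernoulli_weight_def by (intro prod.cong) auto
  finally show ?thesis .
qed

text \<open>
  The measures in view have density \<open>c\<close> with respect to independent edges. The random cluster model
  has \<open>c A = q ^ k\<close> with \<open>k\<close> the number of clusters; \<open>weight_lattice\<close> is the FKG lattice condition.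
\<close>
locale positively_associated_weight =
  fixes E :: "'e set" and c :: "'e set \<Rightarrow> real" and D :: "'e set set"
  assumes finite_E: "finite E"
    and weight_pos: "A \<subseteq> E \<Longrightarrow> 0 < c A"
    and weight_insert: "A \<subseteq> E \<Longrightarrow> e \<in> E \<Longrightarrow> c (insert e A) \<le> c A"
    and weight_lattice: "A \<subseteq> E \<Longrightarrow> B \<subseteq> E \<Longrightarrow> c A * c B \<le> c (A \<union> B) * c (A \<inter> B)"
    and event_subset: "D \<subseteq> Pow E"
    and event_empty: "{} \<in> D"
    and event_decreasing: "A \<in> D \<Longrightarrow> B \<subseteq> A \<Longrightarrow> B \<in> D"
begin

definition partition_fn :: "('e \<Rightarrow> real) \<Rightarrow> 'e set set \<Rightarrow> real" where
  "partition_fn p X = (\<Sum>A\<in>X. bernoulli_weight E p A * c A)"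

definition event_prob :: "('e \<Rightarrow> real) \<Rightarrow> real" where
  "event_prob p = partition_fn p D / partition_fn p (Pow E)"

text \<open>
  The two halves of the partition function of \<open>X\<close>, according to the state of \<open>e\<close>, without the factors
  \<open>1 - p e\<close> and \<open>p e\<close>.
\<close>
definition closed_part :: "('e \<Rightarrow> real) \<Rightarrow> 'e \<Rightarrow> 'e set set \<Rightarrow> real" where
  "closed_part p e X = (\<Sum>A\<in>Pow (E - {e}).
     of_bool (A \<in> X) * bernoulli_weight (E - {e}) p A * c A)"

definition open_part :: "('e \<Rightarrow> real) \<Rightarrow> 'e \<Rightarrow> 'e set set \<Rightarrow> real" where
  "open_part p e X = (\<Sum>A\<in>Pow (E - {e}).
     of_bool (insert e A \<in> X) * bernoulli_weight (E - {e}) p A * c (insert e A))"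

lemma partition_fn_split:
  assumes "e \<in> E" "X \<subseteq> Pow E"
  shows "partition_fn (p(e := t)) X = (1 - t) * closed_part p e X + t * open_part p e X"
proof -
  let ?F = "E - {e}" and ?q = "p(e := t)"
  have E: "insert e ?F = E" and fin: "finite ?F"
    using assms finite_E by auto
  have "partition_fn ?q X = (\<Sum>A\<in>Pow E. of_bool (A \<in> X) * bernoulli_weight E ?q A * c A)"
    unfolding partition_fn_def using assms finite_E
    by (intro sum.mono_neutral_cong_left) auto
  also have "\<dots> = (\<Sum>A\<in>Pow ?F. of_bool (A \<in> X) * bernoulli_weight E ?q A * c A
      + of_bool (insert e A \<in> X) * bernoulli_weight E ?q (insert e A) * c (insert e A))"
    using sum_Pow_insert[OF fin, of e "\<lambda>A. of_bool (A \<in> X) * bernoulli_weight E ?q A * c A"] E by simp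
  also have "\<dots> = (\<Sum>A\<in>Pow ?F. (1 - t) * (of_bool (A \<in> X) * bernoulli_weight ?F p A * c A)
      + t * (of_bool (insert e A \<in> X) * bernoulli_weight ?F p A * c (insert e A)))"
  proof (rule sum.cong)
    fix A assume "A \<in> Pow ?F"
    then have "e \<notin> A"
      by auto
    then show "of_bool (A \<in> X) * bernoulli_weight E ?q A * c A
        + of_bool (insert e A \<in> X) * bernoulli_weight E ?q (insert e A) * c (insert e A)
      = (1 - t) * (of_bool (A \<in> X) * bernoulli_weight ?F p A * c A)
        + t * (of_bool (insert e A \<in> X) * bernoulli_weight ?F p A * c (insert e A))"
      unfolding bernoulli_weight_fun_upd[OF finite_E assms(1)] by simp
  qed simp
  also have "\<dots> = (1 - t) * closed_part p e X + t * open_part p e X"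
    by (simp add: closed_part_def open_part_def sum.distrib sum_distrib_left)
  finally show ?thesis .
qed

context
  fixes p :: "'e \<Rightarrow> real" and e :: 'e
  assumes p: "\<forall>f\<in>E. 0 \<le> p f \<and> p f < 1" and e: "e \<in> E"
begin

lemma bernoulli_weight_nonneg': "0 \<le> bernoulli_weight (E - {e}) p A"
  using p by (intro bernoulli_weight_nonneg) (auto simp: less_imp_le)

lemma part_nonneg: "0 \<le> closed_part p e X" "0 \<le> open_part p e X"
proof -
  have "0 \<le> c A" "0 \<le> c (insert e A)" if "A \<subseteq> E - {e}" for A
    using that e by (auto intro!: less_imp_le[OF weight_pos])
  then show "0 \<le> closed_part p e X" "0 \<le> open_part p e X"
    unfolding closed_part_def open_part_def
    by (auto intro!: sum_nonneg mult_nonneg_nonneg bernoulli_weight_nonneg')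
qed

lemma closed_part_pos:
  assumes "{} \<in> X"
  shows "0 < closed_part p e X"
  unfolding closed_part_def
proof (rule sum_pos2[where i = "{}"])
  show "0 < of_bool ({} \<in> X) * bernoulli_weight (E - {e}) p {} * c {}"
    using assms p weight_pos[of "{}"] bernoulli_weight_empty_pos[of "E - {e}" p] by simp
  show "0 \<le> of_bool (A \<in> X) * bernoulli_weight (E - {e}) p A * c A" if "A \<in> Pow (E - {e})" for A
    using weight_pos[of A] that bernoulli_weight_nonneg' by (auto intro!: mult_nonneg_nonneg less_imp_le[OF weight_pos])
qed (use finite_E in auto)

lemma open_part_le_closed_part: "open_part p e (Pow E) \<le> closed_part p e (Pow E)"
  unfolding closed_part_def open_part_def
proof (rule sum_mono)
  fix A assume "A \<in> Pow (E - {e})"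
  then have "A \<subseteq> E" "insert e A \<subseteq> E"
    using e by auto
  then show "of_bool (insert e A \<in> Pow E) * bernoulli_weight (E - {e}) p A * c (insert e A)
      \<le> of_bool (A \<in> Pow E) * bernoulli_weight (E - {e}) p A * c A"
    using weight_insert[of A e] e bernoulli_weight_nonneg' by (simp add: mult_left_mono)
qed

text \<open>
  The FKG inequality in the form needed here: conditioning on the decreasing event \<open>D\<close> does not favour
  an open edge.
\<close>
lemma open_part_closed_part_correlation:
  "open_part p e D * closed_part p e (Pow E) \<le> open_part p e (Pow E) * closed_part p e D"
  unfolding closed_part_def open_part_def
proof (rule four_functions)
  let ?F = "E - {e}"
  let ?w = "bernoulli_weight ?F p"
  note w = bernoulli_weight_nonneg'
  have c: "0 \<le> c A" "0 \<le> c (insert e A)" if "A \<subseteq> ?F" for A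
    using that e by (auto intro!: less_imp_le[OF weight_pos])
  show "finite ?F"
    using finite_E by simp
  show "0 \<le> of_bool (insert e A \<in> D) * ?w A * c (insert e A) \<and>
       0 \<le> of_bool (A \<in> Pow E) * ?w A * c A \<and>
       0 \<le> of_bool (insert e A \<in> Pow E) * ?w A * c (insert e A) \<and>
       0 \<le> of_bool (A \<in> D) * ?w A * c A" if "A \<subseteq> ?F" for A
    using w c[OF that] by simp
  fix A B assume AB: "A \<subseteq> ?F" "B \<subseteq> ?F"
  have "insert e A \<inter> B = A \<inter> B" "insert e A \<union> B = insert e (A \<union> B)"
    using AB by auto
  then have cc: "c (insert e A) * c B \<le> c (insert e (A \<union> B)) * c (A \<inter> B)"
    using weight_lattice[of "insert e A" B] AB e by auto
  have D: "insert e A \<in> D \<Longrightarrow> A \<inter> B \<in> D"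
    by (rule event_decreasing) auto
  have "(?w A * ?w B) * (c (insert e A) * c B) \<le> (?w A * ?w B) * (c (insert e (A \<union> B)) * c (A \<inter> B))"
    using w cc by (intro mult_left_mono mult_nonneg_nonneg) auto
  also have "\<dots> = (?w (A \<union> B) * ?w (A \<inter> B)) * (c (insert e (A \<union> B)) * c (A \<inter> B))"
    by (simp only: bernoulli_weight_union_inter[of _ _ A])
  finally have main: "(?w A * c (insert e A)) * (?w B * c B)
      \<le> (?w (A \<union> B) * c (insert e (A \<union> B))) * (?w (A \<inter> B) * c (A \<inter> B))"
    by (simp only: mult_ac)
  have nn: "0 \<le> (?w (A \<union> B) * c (insert e (A \<union> B))) * (?w (A \<inter> B) * c (A \<inter> B))"
    using w c[of "A \<union> B"] c[of "A \<inter> B"] AB by (intro mult_nonneg_nonneg) auto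
  have "B \<subseteq> E" "insert e (A \<union> B) \<subseteq> E"
    using AB e by auto
  then show "of_bool (insert e A \<in> D) * ?w A * c (insert e A) * (of_bool (B \<in> Pow E) * ?w B * c B)
      \<le> of_bool (insert e (A \<union> B) \<in> Pow E) * ?w (A \<union> B) * c (insert e (A \<union> B)) *
        (of_bool (A \<inter> B \<in> D) * ?w (A \<inter> B) * c (A \<inter> B))"
    using main nn D by (cases "insert e A \<in> D"; cases "A \<inter> B \<in> D") simp_all
qed

lemma event_prob_edge:
  assumes t: "0 \<le> t" "t < 1"
  shows "event_prob (p(e := t)) \<le> event_prob (p(e := 0))"
    "(1 - t) * event_prob (p(e := 0)) \<le> event_prob (p(e := t))"
    "0 \<le> t' \<Longrightarrow> \<theta> \<in> {0..1} \<Longrightarrow> t' \<le> (1 - \<theta>) * t \<Longrightarrow>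
      event_prob (p(e := 0)) - event_prob (p(e := t'))
        \<le> (1 - \<theta>) * (event_prob (p(e := 0)) - event_prob (p(e := t)))"
proof -
  have pos: "0 < closed_part p e (Pow E)"
    by (simp add: closed_part_pos)
  note * = mobius_ratio_bounds[OF pos part_nonneg(1)[of D] part_nonneg(2)[of D] part_nonneg(2)
      open_part_le_closed_part open_part_closed_part_correlation t]
  have f: "event_prob (p(e := t)) = ((1 - t) * closed_part p e D + t * open_part p e D) /
      ((1 - t) * closed_part p e (Pow E) + t * open_part p e (Pow E))" for t
    by (simp only: event_prob_def partition_fn_split[OF e event_subset] partition_fn_split[OF e order_refl])
  show "event_prob (p(e := t)) \<le> event_prob (p(e := 0))"
    "(1 - t) * event_prob (p(e := 0)) \<le> event_prob (p(e := t))"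
    unfolding f using *(1,2) by auto
  show "event_prob (p(e := 0)) - event_prob (p(e := t'))
        \<le> (1 - \<theta>) * (event_prob (p(e := 0)) - event_prob (p(e := t)))"
    if "0 \<le> t'" "\<theta> \<in> {0..1}" "t' \<le> (1 - \<theta>) * t"
    unfolding f using *(3)[OF that] .
qed

end

lemma event_prob_bounds:
  assumes p: "\<forall>f\<in>E. 0 \<le> p f \<and> p f < 1"
  shows "0 < event_prob p" "event_prob p \<le> 1"
proof -
  have nn: "0 \<le> bernoulli_weight E p A * c A" if "A \<subseteq> E" for A
    using p weight_pos[OF that] bernoulli_weight_nonneg[of E p A] by (simp add: less_imp_le)
  have "0 < bernoulli_weight E p {} * c {}"
    using p weight_pos[of "{}"] bernoulli_weight_empty_pos[of E p] by simp
  then have D: "0 < partition_fn p D"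
    unfolding partition_fn_def using event_subset event_empty nn finite_E
    by (intro sum_pos2[where i = "{}"]) (auto intro: finite_subset)
  have le: "partition_fn p D \<le> partition_fn p (Pow E)"
    unfolding partition_fn_def using event_subset nn finite_E
    by (intro sum_mono2) auto
  show "0 < event_prob p" "event_prob p \<le> 1"
    using D le by (auto simp: event_prob_def)
qed

definition coupling_prob :: "real \<Rightarrow> ('e \<Rightarrow> real) \<Rightarrow> real" where
  "coupling_prob \<beta> a = event_prob (\<lambda>e. 1 - exp (- (\<beta> * a e)))"

lemma coupling_prob_bounds:
  assumes "\<beta> \<ge> 0" "\<forall>e\<in>E. 0 \<le> a e"
  shows "0 < coupling_prob \<beta> a" "coupling_prob \<beta> a \<le> 1"
  using event_prob_bounds[of "\<lambda>e. 1 - exp (- (\<beta> * a e))"] assms by (auto simp: coupling_prob_def)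

lemma coupling_prob_cong: "(\<And>e. e \<in> E \<Longrightarrow> \<beta> * a e = \<beta>' * a' e) \<Longrightarrow> coupling_prob \<beta> a = coupling_prob \<beta>' a'"
  by (auto simp: coupling_prob_def event_prob_def partition_fn_def bernoulli_weight_def
      intro!: arg_cong2[of _ _ _ _ "(/)"] sum.cong arg_cong2[of _ _ _ _ "(*)"] prod.cong)

end

lemma (in positively_associated_weight) coupling_prob_measurable:
  assumes "unit_interval_law \<mu>" "E \<subseteq> I"
  shows "coupling_prob \<beta> \<in> borel_measurable (PiM I (\<lambda>_. \<mu>))"
proof -
  interpret unit_interval_law \<mu> by fact
  have "(\<lambda>a. a e) \<in> borel_measurable (PiM I (\<lambda>_. \<mu>))" if "e \<in> E" for e
    using measurable_compose[OF measurable_component_singleton[OF subsetD[OF assms(2) that]] measurable_id_law]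
    by simp
  then have "(\<lambda>a. if e \<in> A then 1 - exp (- (\<beta> * a e)) else 1 - (1 - exp (- (\<beta> * a e))))
      \<in> borel_measurable (PiM I (\<lambda>_. \<mu>))" if "e \<in> E" for e A
    using that by (cases "e \<in> A") auto
  then show ?thesis
    unfolding coupling_prob_def event_prob_def partition_fn_def bernoulli_weight_def
    by (intro borel_measurable_divide borel_measurable_sum borel_measurable_times
        borel_measurable_prod borel_measurable_const)
qed

text \<open>
  The Edwards--Sokal parametrization \<open>p = 1 - exp (- \<beta> * a)\<close> is used throughout, so scaling all the
  couplings \<open>a\<close> by \<open>s\<close> amounts to replacing \<open>\<beta>\<close> by \<open>s * \<beta>\<close>. The oscillation bound \<open>r * \<beta>\<close> becomes
  small with \<open>r\<close>, whereas the contraction factor depends on \<open>s\<close> and \<open>\<beta>\<close> only.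
\<close>
theorem (in positively_associated_weight) coupling_prob_contracting:
  assumes "unit_interval_law \<mu>" and \<beta>: "\<beta> \<ge> 0" and s: "s \<in> {0..1}" and r: "0 < r" "r \<le> 1"
  shows "unit_interval_law.contracting \<mu> E s ((1 - s) * exp (- \<beta>)) (r * \<beta>) (\<lambda>a. coupling_prob \<beta> a powr r)"
proof -
  interpret unit_interval_law \<mu> by fact
  let ?\<theta> = "(1 - s) * exp (- \<beta>)"
  have \<theta>: "?\<theta> \<in> {0..1}"
    using s \<beta> by (auto intro!: mult_le_one)
  show ?thesis
    unfolding contracting_def
  proof (intro conjI ballI)
    show "(\<lambda>a. coupling_prob \<beta> a powr r) \<in> borel_measurable (PiM E (\<lambda>_. \<mu>))"
      using coupling_prob_measurable[OF assms(1) order_refl] by measurable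
  next
    fix a :: "'e \<Rightarrow> real" assume a: "a \<in> E \<rightarrow>\<^sub>E {0..1}"
    then have a0: "\<forall>e\<in>E. 0 \<le> a e"
      by (auto simp: PiE_iff)
    note bounds = coupling_prob_bounds[OF \<beta> a0]
    show "0 \<le> coupling_prob \<beta> a powr r" "coupling_prob \<beta> a powr r \<le> 1"
      using bounds r by (simp_all add: powr_le1 less_imp_le)
    fix e and t :: real assume e: "e \<in> E" and t: "t \<in> {0..1}"
    define p where "p f = 1 - exp (- (\<beta> * a f))" for f
    have p: "\<forall>f\<in>E. 0 \<le> p f \<and> p f < 1"
      using a0 \<beta> by (simp add: p_def)
    define T where "T y = 1 - exp (- (\<beta> * y))" for y
    have cp: "coupling_prob \<beta> (a(e := y)) = event_prob (p(e := T y))" for y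
      unfolding coupling_prob_def p_def T_def by (rule arg_cong[of _ _ event_prob]) auto
    have T: "0 \<le> T t" "T t < 1" "0 \<le> T (s * t)" "T 0 = 0"
      using t s \<beta> by (auto simp: T_def)
    have Tst: "T (s * t) \<le> (1 - ?\<theta>) * T t"
      unfolding T_def by (rule one_minus_exp_scaled_le[OF \<beta> s t])
    note edge = event_prob_edge[OF p e T(1,2)]
    have nn: "0 < coupling_prob \<beta> (a(e := y))" if "0 \<le> y" for y
      using a0 that \<beta> by (intro coupling_prob_bounds) auto
    have nn': "0 < coupling_prob \<beta> (a(e := t))" "0 < coupling_prob \<beta> (a(e := 0))"
      "0 < coupling_prob \<beta> (a(e := s * t))"
      using nn t s by auto
    show "coupling_prob \<beta> (a(e := t)) powr r \<le> coupling_prob \<beta> (a(e := 0)) powr r"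
      using edge(1) nn' r unfolding cp T(4) by (intro powr_mono2) auto
    have "1 - r * \<beta> \<le> exp (- (\<beta> * t) * r)"
    proof -
      have "\<beta> * t * r \<le> \<beta> * r"
        using t \<beta> r by (intro mult_right_mono mult_left_le) auto
      then show ?thesis
        using exp_ge_add_one_self[of "- (\<beta> * t) * r"] by (simp add: mult.commute)
    qed
    also have "\<dots> = (1 - T t) powr r"
      by (simp add: T_def powr_def mult.commute)
    finally have "(1 - r * \<beta>) * coupling_prob \<beta> (a(e := 0)) powr r
        \<le> (1 - T t) powr r * coupling_prob \<beta> (a(e := 0)) powr r"
      by (intro mult_right_mono) auto
    also have "\<dots> = ((1 - T t) * coupling_prob \<beta> (a(e := 0))) powr r"
      by (rule powr_mult[symmetric])
    also have "\<dots> \<le> coupling_prob \<beta> (a(e := t)) powr r"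
      using edge(2) nn' T r unfolding cp T(4) by (intro powr_mono2) auto
    finally show "(1 - r * \<beta>) * coupling_prob \<beta> (a(e := 0)) powr r \<le> coupling_prob \<beta> (a(e := t)) powr r" .
    show "coupling_prob \<beta> (a(e := 0)) powr r - coupling_prob \<beta> (a(e := s * t)) powr r
        \<le> (1 - ?\<theta>) * (coupling_prob \<beta> (a(e := 0)) powr r - coupling_prob \<beta> (a(e := t)) powr r)"
      using nn' edge(1) edge(3)[OF T(3) \<theta> Tst] \<theta> r unfolding cp T(4)
      by (intro contraction_powr) auto
  qed
qed

text \<open>
  A higher moment at inverse temperature \<open>\<beta>\<close> is bounded by a lower moment at the smaller inverse
  temperature \<open>s * \<beta>\<close>, in the manner of hypercontractivity and with no dependence on the number of
  edges. For \<open>p = 1\<close> there is no second-order loss to absorb and any \<open>s\<close> is allowed, which gives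
  monotonicity in \<open>\<beta>\<close>.
\<close>
theorem (in positively_associated_weight) coupling_prob_moment_le:
  assumes law: "unit_interval_law \<mu>" and "E \<subseteq> I"
    and \<beta>: "\<beta> \<ge> 0" and s: "s \<in> {0..1}" and r: "0 < r" "r \<le> 1" and p: "p \<ge> 1"
    and smaller: "p = 1 \<or> p * r * \<beta> \<le> 2 * ((1 - s) * exp (- \<beta>))"
  shows "(\<integral>a. coupling_prob \<beta> a powr (r * p) \<partial>PiM I (\<lambda>_. \<mu>))
    \<le> (\<integral>a. coupling_prob (s * \<beta>) a powr r \<partial>PiM I (\<lambda>_. \<mu>)) powr p"
proof -
  interpret unit_interval_law \<mu> by fact
  interpret product_prob_space "\<lambda>_. \<mu>" I
    by unfold_locales
  let ?P = "PiM E (\<lambda>_. \<mu>)" and ?\<theta> = "(1 - s) * exp (- \<beta>)"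
  have P: "?P = distr (PiM I (\<lambda>_. \<mu>)) ?P (\<lambda>a. restrict a E)"
    using distr_PiM_restrict_finite[OF finite_E \<open>E \<subseteq> I\<close>] by simp
  have restr: "(\<integral>a. coupling_prob \<gamma> a powr k \<partial>PiM I (\<lambda>_. \<mu>)) = (\<integral>a. coupling_prob \<gamma> a powr k \<partial>?P)" for \<gamma> k
  proof -
    have "(\<integral>a. coupling_prob \<gamma> a powr k \<partial>?P)
        = (\<integral>a. coupling_prob \<gamma> (restrict a E) powr k \<partial>PiM I (\<lambda>_. \<mu>))"
      using coupling_prob_measurable[OF law order_refl, of \<gamma>] \<open>E \<subseteq> I\<close>
      by (subst P, subst integral_distr) (auto intro!: measurable_restrict_subset)
    also have "\<dots> = (\<integral>a. coupling_prob \<gamma> a powr k \<partial>PiM I (\<lambda>_. \<mu>))"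
      by (intro Bochner_Integration.integral_cong refl arg_cong2[where f = "(powr)"] coupling_prob_cong) auto
    finally show ?thesis ..
  qed
  have "(\<integral>a. (coupling_prob \<beta> a powr r) powr p \<partial>?P)
      \<le> (\<integral>a. coupling_prob \<beta> (\<lambda>e\<in>E. s * a e) powr r \<partial>?P) powr p"
  proof (rule contracting_integral_powr_le[OF finite_E coupling_prob_contracting[OF law \<beta> s r] s p])
    fix x :: real assume x: "0 \<le> x" "x \<le> 1" "x \<le> r * \<beta>"
    show "(1 - x) powr p \<le> 1 - p * (1 - ?\<theta>) * x"
    proof (cases "p = 1")
      case True
      then show ?thesis
        using x s by (simp add: algebra_simps mult_left_le_one_le)
    next
      case False
      then show ?thesis
        using smaller x p by (intro one_minus_powr_le[where b = "r * \<beta>"]) (auto simp: mult.assoc)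
    qed
  qed
  also have "(\<integral>a. coupling_prob \<beta> (\<lambda>e\<in>E. s * a e) powr r \<partial>?P) = (\<integral>a. coupling_prob (s * \<beta>) a powr r \<partial>?P)"
    by (intro Bochner_Integration.integral_cong refl arg_cong2[where f = "(powr)"] coupling_prob_cong) auto
  finally show ?thesis
    by (simp add: restr powr_powr)
qed

section \<open>The random cluster model in a parallelepiped\<close>
lemma lattice_box_finite: "finite {z :: int ^ 'd. \<forall>i. \<bar>z $ i\<bar> \<le> K}"
proof -
  have "{z :: int ^ 'd. \<forall>i. \<bar>z $ i\<bar> \<le> K} \<subseteq> vec_lambda ` (UNIV \<rightarrow>\<^sub>E {-K..K})"
  proof
    fix z :: "int ^ 'd" assume "z \<in> {z. \<forall>i. \<bar>z $ i\<bar> \<le> K}"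
    then have "vec_nth z \<in> UNIV \<rightarrow>\<^sub>E {-K..K}"
      by (auto simp: abs_le_iff) (metis minus_le_iff)
    then show "z \<in> vec_lambda ` (UNIV \<rightarrow>\<^sub>E {-K..K})"
      by (metis image_eqI vec_nth_inverse)
  qed
  then show ?thesis
    by (rule finite_subset) (intro finite_imageI finite_PiE, auto)
qed

lemma lattice_points_finite:
  assumes "bounded R"
  shows "finite (lattice_points R)"
proof -
  obtain K where K: "\<And>x. x \<in> R \<Longrightarrow> norm x \<le> K"
    using assms by (auto simp: bounded_iff)
  have "lattice_points R \<subseteq> {z. \<forall>i. \<bar>z $ i\<bar> \<le> \<lfloor>K\<rfloor>}"
  proof (safe)
    fix z i assume "z \<in> lattice_points R"
    then have "norm (emb z) \<le> K"
      using K interior_subset by (auto simp: lattice_points_def)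
    then have "\<bar>real_of_int (z $ i)\<bar> \<le> K"
      using component_le_norm_cart[of "emb z" i] by (simp add: emb_def)
    then show "\<bar>z $ i\<bar> \<le> \<lfloor>K\<rfloor>"
      by (simp add: le_floor_iff)
  qed
  then show ?thesis
    by (rule finite_subset) (rule lattice_box_finite)
qed

lemma unit_cube_bounded:
  assumes "S \<in> unit_cubes n"
  shows "bounded S"
proof -
  obtain B where S: "S = {\<Sum>u\<in>B - {n}. t u *\<^sub>R u | t. \<forall>u\<in>B - {n}. t u \<in> {-1/2..1/2}}"
    and B: "\<forall>b\<in>B. norm b = 1"
    using assms by (auto simp: unit_cubes_def)
  have "norm x \<le> (\<Sum>u\<in>B - {n}. 1)" if x: "x \<in> S" for x
  proof -
    obtain t where t: "x = (\<Sum>u\<in>B - {n}. t u *\<^sub>R u)" "\<forall>u\<in>B - {n}. t u \<in> {-1/2..1/2}"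
      using x unfolding S by blast
    have "norm (t u *\<^sub>R u) \<le> 1" if "u \<in> B - {n}" for u
    proof -
      have "t u \<in> {-1/2..1/2}"
        using t(2) that by blast
      then show ?thesis
        using B that by (simp add: abs_le_iff)
    qed
    then show ?thesis
      unfolding t(1) by (rule sum_norm_le)
  qed
  then show ?thesis
    unfolding bounded_iff by blast
qed

lemma parallelepiped_bounded:
  assumes "bounded S"
  shows "bounded (parallelepiped x L H S n)"
proof -
  obtain K where K: "\<And>s. s \<in> S \<Longrightarrow> norm s \<le> K"
    using assms by (auto simp: bounded_iff)
  have "norm y \<le> norm x + \<bar>L\<bar> * K + \<bar>H\<bar> * norm n" if y: "y \<in> parallelepiped x L H S n" for y
  proof -
    obtain s t where st: "y = x + L *\<^sub>R s + t *\<^sub>R n" "s \<in> S" "t \<in> {-H..H}"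
      using y by (auto simp: parallelepiped_def)
    have "norm y \<le> norm x + norm (L *\<^sub>R s) + norm (t *\<^sub>R n)"
      unfolding st(1) by (intro norm_triangle_le add_mono norm_triangle_ineq order_refl)
    also have "norm (L *\<^sub>R s) \<le> \<bar>L\<bar> * K"
      using K[OF st(2)] by (simp add: mult_left_mono)
    also have "norm (t *\<^sub>R n) \<le> \<bar>H\<bar> * norm n"
      using st(3) by (auto intro!: mult_right_mono)
    finally show ?thesis
      by simp
  qed
  then show ?thesis
    unfolding bounded_iff by blast
qed

lemma edges_finite: "finite A \<Longrightarrow> finite (edges A)"
  by (rule finite_subset[of _ "Pow A"]) (auto simp: edges_def)

text \<open>
  The number of clusters decreases and is supermodular in the open edges, and \<open>q \<ge> 1\<close> transfers both
  properties to the weight. The empty configuration disconnects because no site is on both sides.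
\<close>
lemma random_cluster_associated:
  fixes n :: "real ^ 'd" and A :: "(int ^ 'd) set"
  assumes "finite A" "q \<ge> 1"
  shows "positively_associated_weight (edges A)
    (\<lambda>\<omega>. q ^ cluster_count (edges A) \<pi> \<omega>) (disconnection x n A)"
proof
  show fin: "finite (edges A)"
    using assms(1) by (rule edges_finite)
  have V: "finite (\<Union>(edges A))"
    using assms(1) by (rule finite_subset[rotated]) (auto simp: edges_def)
  have E: "\<exists>u v. e = {u, v}" if "e \<in> edges A" for e
    using that by (auto simp: edges_def)
  show "0 < q ^ cluster_count (edges A) \<pi> \<omega>" for \<omega>
    using assms by simp
  show "q ^ cluster_count (edges A) \<pi> (insert e \<omega>) \<le> q ^ cluster_count (edges A) \<pi> \<omega>"
    if "e \<in> edges A" for \<omega> e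
    using E[OF that] that assms cluster_count_insert_le[OF V] by (auto intro!: power_increasing)
  show "q ^ cluster_count (edges A) \<pi> \<omega> * q ^ cluster_count (edges A) \<pi> \<eta>
      \<le> q ^ cluster_count (edges A) \<pi> (\<omega> \<union> \<eta>) * q ^ cluster_count (edges A) \<pi> (\<omega> \<inter> \<eta>)"
    if "\<omega> \<subseteq> edges A" "\<eta> \<subseteq> edges A" for \<omega> \<eta>
    unfolding power_add[symmetric]
    using cluster_count_supermodular[OF fin V E that] assms by (intro power_increasing) auto
  show "disconnection x n A \<subseteq> Pow (edges A)"
    by (auto simp: disconnection_def)
  show "{} \<in> disconnection x n A"
    by (auto simp: disconnection_def connected_by_empty upper_boundary_def lower_boundary_def)
  show "\<eta> \<in> disconnection x n A" if "\<omega> \<in> disconnection x n A" "\<eta> \<subseteq> \<omega>" for \<omega> \<eta>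
    using that(1) order_trans[OF that(2)] connected_by_mono[OF that(2)]
    unfolding disconnection_def by blast
qed

lemma measure_random_cluster_eq_coupling_prob:
  fixes n :: "real ^ 'd" and A :: "(int ^ 'd) set"
  assumes "finite A" "q \<ge> 1" "\<beta> \<ge> 0" and J: "\<And>e. e \<in> edges A \<Longrightarrow> 0 \<le> J e"
  shows "measure (random_cluster J \<pi> q \<beta> (edges A)) (disconnection x n A)
    = positively_associated_weight.coupling_prob (edges A)
        (\<lambda>\<omega>. q ^ cluster_count (edges A) \<pi> \<omega>) (disconnection x n A) \<beta> J"
proof -
  interpret positively_associated_weight "edges A" "\<lambda>\<omega>. q ^ cluster_count (edges A) \<pi> \<omega>"
    "disconnection x n A"
    using assms by (intro random_cluster_associated)
  let ?p = "\<lambda>e. 1 - exp (- (\<beta> * J e))"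
  let ?W = "rc_weight J \<pi> q \<beta> (edges A)"
  have W: "?W \<omega> = bernoulli_weight (edges A) ?p \<omega> * q ^ cluster_count (edges A) \<pi> \<omega>" for \<omega>
    by (simp add: rc_weight_def bernoulli_weight_def Let_def)
  have nn: "0 \<le> ?W \<omega>" for \<omega>
    using assms unfolding W by (intro mult_nonneg_nonneg bernoulli_weight_nonneg) auto
  have "measure (random_cluster J \<pi> q \<beta> (edges A)) (disconnection x n A)
      = (\<Sum>\<omega>\<in>disconnection x n A. ?W \<omega> / (\<Sum>\<eta>\<in>Pow (edges A). ?W \<eta>))"
    unfolding random_cluster_def measure_def
    using nn finite_E event_subset
    by (subst emeasure_point_measure_finite) (auto simp: sum_nonneg intro!: enn2real_eq_posreal_iff[THEN iffD2])
  also have "\<dots> = coupling_prob \<beta> J"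
    by (simp add: coupling_prob_def event_prob_def partition_fn_def W sum_divide_distrib)
  finally show ?thesis .
qed

section \<open>Lower deviations of the surface tension in a finite box\<close>
context unit_interval_law
begin

context
  fixes x n :: "real ^ 'd" and S :: "(real ^ 'd) set" and L H q :: real
  assumes S: "bounded S" and L: "L \<ge> 1" and q: "q \<ge> 1"
begin

abbreviation tension :: "real \<Rightarrow> ((int ^ 'd) set \<Rightarrow> real) \<Rightarrow> real" where
  "tension \<beta> J \<equiv> surface_tension J q \<beta> x L H S n"

text \<open>
  In terms of the tension the basic power is \<open>1 / L ^ (d - 1)\<close>, since
  \<open>exp (- tension) = \<Phi>(D) powr (1 / L ^ (d - 1))\<close>. The exponent \<open>p\<close> may therefore grow like
  \<open>L ^ (d - 1)\<close> at a fixed cost in \<open>\<beta>\<close>: a bound on the scale of surface order large deviations.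
\<close>
lemma tension_moments:
  assumes \<beta>: "\<beta> \<ge> 0"
  shows tension_measurable: "tension \<beta> \<in> borel_measurable (couplings \<mu>)" (is ?measurable)
    and tension_nonneg: "J \<in> space (couplings \<mu>) \<Longrightarrow> 0 \<le> tension \<beta> J" (is "_ \<Longrightarrow> ?nonneg")
    and tension_moment_le: "\<lbrakk>s \<in> {0..1}; p \<ge> 1;
        p = 1 \<or> p * \<beta> \<le> 2 * (1 - s) * exp (- \<beta>) * L ^ (CARD('d) - 1)\<rbrakk> \<Longrightarrow>
      (\<integral>J. exp (- (p * tension \<beta> J)) \<partial>couplings \<mu>)
        \<le> (\<integral>J. exp (- tension (s * \<beta>) J) \<partial>couplings \<mu>) powr p" (is "\<lbrakk>_; _; _\<rbrakk> \<Longrightarrow> ?moment")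
proof -
  define A where "A = lattice_points (parallelepiped x L H S n)"
  have A: "finite A"
    unfolding A_def by (intro lattice_points_finite parallelepiped_bounded S)
  interpret positively_associated_weight "edges A" "\<lambda>\<omega>. q ^ cluster_count (edges A) (wired (edges A)) \<omega>"
    "disconnection x n A"
    by (rule random_cluster_associated[OF A q])
  define r where "r = 1 / L ^ (CARD('d) - 1)"
  have r: "0 < r" "r \<le> 1"
    using L by (auto simp: r_def one_le_power intro!: divide_pos_pos zero_less_power)
  have EI: "edges A \<subseteq> edges (UNIV :: (int ^ 'd) set)"
    by (auto simp: edges_def)
  have law: "unit_interval_law \<mu>"
    by unfold_locales
  have J0: "0 \<le> J e" if "J \<in> space (couplings \<mu>)" "e \<in> edges A" for J e
    using that EI by (auto simp: couplings_def space_PiM_law PiE_iff)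
  have tension: "tension \<gamma> J = - (r * ln (coupling_prob \<gamma> J))"
    if "\<gamma> \<ge> 0" "J \<in> space (couplings \<mu>)" for \<gamma> J
    using measure_random_cluster_eq_coupling_prob[OF A q \<open>\<gamma> \<ge> 0\<close> J0[OF that(2)]]
    by (simp add: surface_tension_def A_def[symmetric] Let_def r_def)
  have exp_tension: "exp (- (p * tension \<gamma> J)) = coupling_prob \<gamma> J powr (r * p)"
    if "\<gamma> \<ge> 0" "J \<in> space (couplings \<mu>)" for \<gamma> J p
  proof -
    have "0 < coupling_prob \<gamma> J"
      using that J0 by (intro coupling_prob_bounds) auto
    then show ?thesis
      by (simp add: tension[OF that] powr_def algebra_simps)
  qed
  have "(\<lambda>J. - (r * ln (coupling_prob \<beta> J))) \<in> borel_measurable (couplings \<mu>)"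
    using coupling_prob_measurable[OF law EI, of \<beta>] by (simp add: couplings_def)
  then show ?measurable
    by (rule measurable_cong[THEN iffD2, rotated]) (rule tension[OF \<beta>])
  show ?nonneg if "J \<in> space (couplings \<mu>)"
    using coupling_prob_bounds[OF \<beta>, of J] J0[OF that] r
    by (simp add: tension[OF \<beta> that] mult_le_0_iff)
  show ?moment if s: "s \<in> {0..1}" and p: "p \<ge> 1"
    and smaller: "p = 1 \<or> p * \<beta> \<le> 2 * (1 - s) * exp (- \<beta>) * L ^ (CARD('d) - 1)"
  proof -
    have "p = 1 \<or> p * r * \<beta> \<le> 2 * ((1 - s) * exp (- \<beta>))"
      using smaller L by (auto simp: r_def field_simps)
    from coupling_prob_moment_le[OF law EI \<beta> s r p this]
    have "(\<integral>J. coupling_prob \<beta> J powr (r * p) \<partial>couplings \<mu>)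
        \<le> (\<integral>J. coupling_prob (s * \<beta>) J powr (r * 1) \<partial>couplings \<mu>) powr p"
      by (simp add: couplings_def)
    also have "(\<integral>J. coupling_prob (s * \<beta>) J powr (r * 1) \<partial>couplings \<mu>)
        = (\<integral>J. exp (- (1 * tension (s * \<beta>) J)) \<partial>couplings \<mu>)"
      using s \<beta> by (intro Bochner_Integration.integral_cong refl exp_tension[symmetric]) auto
    also have "(\<integral>J. coupling_prob \<beta> J powr (r * p) \<partial>couplings \<mu>)
        = (\<integral>J. exp (- (p * tension \<beta> J)) \<partial>couplings \<mu>)"
      using \<beta> by (intro Bochner_Integration.integral_cong refl exp_tension[symmetric])
    finally show ?thesis
      by simp
  qed
qed

lemma prob_space_couplings: "prob_space (couplings \<mu> :: ((int ^ 'd) set \<Rightarrow> real) measure)"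
  unfolding couplings_def by (rule prob_space_PiM_law)

lemma exp_tension_integrable:
  assumes "\<beta> \<ge> 0" "p \<ge> 0"
  shows "integrable (couplings \<mu>) (\<lambda>J. exp (- (p * tension \<beta> J)))"
proof -
  interpret C: prob_space "couplings \<mu> :: ((int ^ 'd) set \<Rightarrow> real) measure"
    by (rule prob_space_couplings)
  note [measurable] = tension_measurable[OF assms(1)]
  show ?thesis
    using assms tension_nonneg[OF assms(1)] by (intro C.integrable_const_bound[where B = 1]) (auto intro!: AE_I2)
qed

abbreviation tension_laplace :: "real \<Rightarrow> real" where
  "tension_laplace \<beta> \<equiv> (\<integral>J. exp (- tension \<beta> J) \<partial>couplings \<mu>)"

lemma tension_laplace_bounds:
  assumes "\<beta> \<ge> 0"
  shows "0 \<le> tension_laplace \<beta>" "tension_laplace \<beta> \<le> 1"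
proof -
  interpret C: prob_space "couplings \<mu> :: ((int ^ 'd) set \<Rightarrow> real) measure"
    by (rule prob_space_couplings)
  show "0 \<le> tension_laplace \<beta>"
    by simp
  show "tension_laplace \<beta> \<le> 1"
    using exp_tension_integrable[OF assms, of 1] tension_nonneg[OF assms]
    by (intro C.integral_le_const) (auto intro!: AE_I2)
qed

lemma tension_laplace_antimono:
  assumes "0 \<le> \<beta>'" "\<beta>' \<le> \<beta>"
  shows "tension_laplace \<beta> \<le> tension_laplace \<beta>'"
proof (cases "\<beta> = 0")
  case False
  have "0 \<le> tension_laplace \<beta>'"
    by simp
  then show ?thesis
    using tension_moment_le[of \<beta> "\<beta>' / \<beta>" 1] assms False by simp
qed (use assms in simp)

text \<open>
  The Chernoff bound combined with the moment inequality between \<open>\<beta>\<close> and \<open>\<beta>'\<close>.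
\<close>
lemma prob_tension_le:
  assumes "0 < \<beta>" "0 \<le> \<beta>'" "\<beta>' \<le> \<beta>" and p: "p \<ge> 1"
    and smaller: "p * \<beta>\<^sup>2 \<le> 2 * (\<beta> - \<beta>') * exp (- \<beta>) * L ^ (CARD('d) - 1)"
  shows "measure (couplings \<mu>) {J \<in> space (couplings \<mu>). tension \<beta> J \<le> t}
    \<le> exp (p * t) * tension_laplace \<beta>' powr p"
proof -
  note [measurable] = tension_measurable[OF less_imp_le[OF assms(1)]]
  have "{J \<in> space (couplings \<mu>). tension \<beta> J \<le> t}
      = {J \<in> space (couplings \<mu>). exp (- (p * t)) \<le> exp (- (p * tension \<beta> J))}"
    using p by auto
  then have "measure (couplings \<mu>) {J \<in> space (couplings \<mu>). tension \<beta> J \<le> t}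
      \<le> (\<integral>J. exp (- (p * tension \<beta> J)) \<partial>couplings \<mu>) / exp (- (p * t))"
    using integral_Markov_inequality_measure[OF exp_tension_integrable[of \<beta> p] sets.empty_sets,
        where c = "exp (- (p * t))"] assms(1) p by simp
  also have "\<dots> = exp (p * t) * (\<integral>J. exp (- (p * tension \<beta> J)) \<partial>couplings \<mu>)"
    by (simp add: exp_minus field_simps)
  also have "\<dots> \<le> exp (p * t) * tension_laplace \<beta>' powr p"
  proof (rule mult_left_mono)
    have "p * \<beta> \<le> 2 * (1 - \<beta>' / \<beta>) * exp (- \<beta>) * L ^ (CARD('d) - 1)"
    proof -
      have "\<beta> - \<beta>' = \<beta> * (1 - \<beta>' / \<beta>)"
        using assms(1) by (simp add: field_simps)
      then have "\<beta> * (p * \<beta>) \<le> \<beta> * (2 * (1 - \<beta>' / \<beta>) * exp (- \<beta>) * L ^ (CARD('d) - 1))"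
        using smaller by (simp add: power2_eq_square mult_ac)
      then show ?thesis
        using assms(1) by simp
    qed
    then show "(\<integral>J. exp (- (p * tension \<beta> J)) \<partial>couplings \<mu>) \<le> tension_laplace \<beta>' powr p"
      using tension_moment_le[of \<beta> "\<beta>' / \<beta>" p] assms by simp
  qed simp
  finally show ?thesis .
qed

lemma tension_laplace_le_exp:
  assumes "\<beta> \<ge> 0"
  shows "tension_laplace \<beta> \<le> exp (\<epsilon> - \<tau>)
    + measure (couplings \<mu>) {J \<in> space (couplings \<mu>). \<bar>tension \<beta> J - \<tau>\<bar> > \<epsilon>}"
proof -
  interpret C: prob_space "couplings \<mu> :: ((int ^ 'd) set \<Rightarrow> real) measure"
    by (rule prob_space_couplings)
  note [measurable] = tension_measurable[OF assms]
  let ?B = "{J \<in> space (couplings \<mu>). \<bar>tension \<beta> J - \<tau>\<bar> > \<epsilon>}"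
  have B: "?B \<in> sets (couplings \<mu>)"
    by measurable
  have "tension_laplace \<beta> \<le> (\<integral>J. exp (\<epsilon> - \<tau>) + indicator ?B J \<partial>couplings \<mu>)"
  proof (rule integral_mono)
    show "integrable (couplings \<mu>) (\<lambda>J. exp (- tension \<beta> J))"
      using exp_tension_integrable[OF assms, of 1] by simp
    show "integrable (couplings \<mu>) (\<lambda>J. exp (\<epsilon> - \<tau>) + indicator ?B J :: real)"
      using B by (intro Bochner_Integration.integrable_add integrable_real_indicator)
        (auto simp: C.emeasure_finite less_top[symmetric])
    fix J :: "(int ^ 'd) set \<Rightarrow> real" assume J: "J \<in> space (couplings \<mu>)"
    show "exp (- tension \<beta> J) \<le> exp (\<epsilon> - \<tau>) + indicator ?B J"
    proof (cases "J \<in> ?B")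
      case True
      have "exp (- tension \<beta> J) \<le> 1"
        using tension_nonneg[OF assms J] by simp
      then show ?thesis
        using True by (simp add: add_increasing)
    next
      case False
      then have "\<bar>tension \<beta> J - \<tau>\<bar> \<le> \<epsilon>"
        using J by auto
      then show ?thesis
        using False by simp
    qed
  qed
  also have "\<dots> = exp (\<epsilon> - \<tau>) + measure (couplings \<mu>) ?B"
    using B by (subst Bochner_Integration.integral_add) (auto simp: C.emeasure_finite less_top[symmetric] C.prob_space)
  finally show ?thesis .
qed

end

end

section \<open>Left difference quotients of monotone functions\<close>

text \<open>
  The integral of the difference quotient over a window telescopes to an integral over a strip of
  width \<open>h\<close>, divided by \<open>h\<close>, and so stays bounded by \<open>1\<close>; by the lemma of Fatou the lower limit of the
  quotients is finite almost everywhere. Only infinitely many steps \<open>h\<close> are controlled, which is the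
  reason for a limit superior in the main theorem.
\<close>
lemma AE_bounded_left_difference_quotient:
  fixes g :: "real \<Rightarrow> real"
  assumes anti: "antimono g" and bounds: "\<And>x. 0 \<le> g x" "\<And>x. g x \<le> 1"
  shows "AE x in lborel. \<exists>C. \<exists>\<^sub>F k in sequentially. g (x - inverse (real (Suc k))) \<le> g x + C * inverse (real (Suc k))"
proof -
  define h where "h k = inverse (real (Suc k))" for k
  have h: "0 < h k" "h k \<le> 1" for k
    by (auto simp: h_def inverse_le_1_iff)
  define F where "F k x = ennreal ((g (x - h k) - g x) / h k)" for k x
  have [measurable]: "g \<in> borel_measurable borel"
  proof -
    have "(\<lambda>x. - g x) \<in> borel_measurable borel"
      using anti by (intro borel_measurable_mono) (auto simp: monotone_def)
    then show ?thesis
      by simp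
  qed
  have [measurable]: "F k \<in> borel_measurable borel" for k
    unfolding F_def by measurable
  have diff: "0 \<le> g (x - h k) - g x" for k x
    using antimonoD[OF anti, of "x - h k" x] h(1)[of k] by simp
  have int: "(\<integral>\<^sup>+x. F k x * indicator {-real m..real m} x \<partial>lborel) \<le> 1" for k m
  proof -
    let ?W = "{-real m..real m}"
    let ?G = "(\<integral>\<^sup>+x. ennreal (g x) * indicator ?W x \<partial>lborel)"
    have "?G + ennreal (h k) * (\<integral>\<^sup>+x. F k x * indicator ?W x \<partial>lborel)
        = (\<integral>\<^sup>+x. ennreal (g (x - h k)) * indicator ?W x \<partial>lborel)"
    proof -
      have "ennreal (g (x - h k)) = ennreal (g x) + ennreal (h k) * F k x" for x
        unfolding F_def using diff[of x k] h(1)[of k] bounds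
        by (simp flip: ennreal_mult' ennreal_plus)
      then show ?thesis
        by (simp add: nn_integral_add[symmetric] nn_integral_cmult[symmetric] distrib_right mult.assoc)
    qed
    also have "\<dots> = (\<integral>\<^sup>+x. ennreal (g x) * indicator ?W (x + h k) \<partial>lborel)"
      using nn_integral_real_affine[of "\<lambda>x. ennreal (g (x - h k)) * indicator ?W x" 1 "h k"]
      by (simp add: add.commute)
    also have "\<dots> \<le> (\<integral>\<^sup>+x. ennreal (g x) * indicator ?W x + indicator {-real m - h k..-real m} x \<partial>lborel)"
    proof (rule nn_integral_mono)
      fix x
      show "ennreal (g x) * indicator ?W (x + h k)
          \<le> ennreal (g x) * indicator ?W x + indicator {-real m - h k..-real m} x"
        using h(1)[of k] bounds(2)[of x]
        by (auto simp: indicator_def ennreal_le_1 add_increasing split: if_splits)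
    qed
    also have "\<dots> = ?G + ennreal (h k)"
      using h(1)[of k] by (simp add: nn_integral_add)
    finally have le: "?G + ennreal (h k) * (\<integral>\<^sup>+x. F k x * indicator ?W x \<partial>lborel) \<le> ?G + ennreal (h k)" .
    have "?G \<le> (\<integral>\<^sup>+x. indicator ?W x \<partial>lborel)"
      using bounds(2) by (intro nn_integral_mono) (auto simp: indicator_def ennreal_le_1)
    also have "\<dots> < \<infinity>"
      by simp
    finally have "ennreal (h k) * (\<integral>\<^sup>+x. F k x * indicator ?W x \<partial>lborel) \<le> ennreal (h k) * 1"
      using le by (auto simp: ennreal_add_left_cancel_le)
    then show ?thesis
      using h(1)[of k] by (subst (asm) ennreal_mult_le_mult_iff) auto
  qed
  have ae: "AE x in lborel. liminf (\<lambda>k. F k x * indicator {-real m..real m} x) \<noteq> \<infinity>" for m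
  proof (rule nn_integral_PInf_AE)
    have "(\<integral>\<^sup>+x. liminf (\<lambda>k. F k x * indicator {-real m..real m} x) \<partial>lborel)
        \<le> liminf (\<lambda>k. \<integral>\<^sup>+x. F k x * indicator {-real m..real m} x \<partial>lborel)"
      by (intro nn_integral_liminf) measurable
    also have "\<dots> \<le> liminf (\<lambda>k::nat. 1::ennreal)"
      by (intro Liminf_mono) (simp add: int)
    finally show "(\<integral>\<^sup>+x. liminf (\<lambda>k. F k x * indicator {-real m..real m} x) \<partial>lborel) \<noteq> \<infinity>"
      by (auto simp: Liminf_const top_unique)
  qed measurable
  then have "AE x in lborel. \<forall>m::nat. liminf (\<lambda>k. F k x * indicator {-real m..real m} x) \<noteq> \<infinity>"
    by (simp add: AE_all_countable)
  then show ?thesis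
  proof (rule AE_mp, intro AE_I2 impI)
    fix x assume fin: "\<forall>m::nat. liminf (\<lambda>k. F k x * indicator {-real m..real m} x) \<noteq> \<infinity>"
    obtain m :: nat where "\<bar>x\<bar> \<le> real m"
      using real_arch_simple by blast
    then have "x \<in> {-real m..real m}"
      by auto
    then have "liminf (\<lambda>k. F k x) \<noteq> \<infinity>"
      using fin[rule_format, of m] by simp
    then obtain C where C: "liminf (\<lambda>k. F k x) < ennreal C" "0 \<le> C"
      by (metis ennreal_Ex_less_of_nat ennreal_of_nat_eq_real_of_nat infinity_ennreal_def less_top of_nat_0_le_iff)
    have "\<exists>\<^sub>F k in sequentially. F k x < ennreal C"
    proof (rule ccontr)
      assume "\<not> ?thesis"
      then have "eventually (\<lambda>k. ennreal C \<le> F k x) sequentially"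
        by (simp add: not_frequently not_less)
      then have "ennreal C \<le> liminf (\<lambda>k. F k x)"
        by (rule Liminf_bounded)
      then show False
        using C by simp
    qed
    moreover have "g (x - h k) \<le> g x + C * h k" if "F k x < ennreal C" for k
      using that h(1)[of k] C(2) diff[of x k] unfolding F_def
      by (auto simp: ennreal_less_iff field_simps)
    ultimately have "\<exists>\<^sub>F k in sequentially. g (x - h k) \<le> g x + C * h k"
      by (rule frequently_elim1)
    then show "\<exists>C. \<exists>\<^sub>F k in sequentially. g (x - inverse (real (Suc k))) \<le> g x + C * inverse (real (Suc k))"
      unfolding h_def by (rule exI)
  qed
qed

section \<open>The limiting Laplace transform\<close>

text \<open>
  A real-valued limit superior, for sequences that are eventually bounded.
\<close>
definition upper_limit :: "(nat \<Rightarrow> real) \<Rightarrow> real" where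
  "upper_limit X = Inf {c. \<forall>\<^sub>F N in sequentially. X N \<le> c}"

lemma upper_limit_le:
  assumes "\<forall>\<^sub>F N in sequentially. 0 \<le> X N" "\<forall>\<^sub>F N in sequentially. X N \<le> c"
  shows "upper_limit X \<le> c"
proof -
  have "0 \<le> c" if "\<forall>\<^sub>F N in sequentially. X N \<le> c" for c
  proof -
    have "\<forall>\<^sub>F N in sequentially. 0 \<le> c"
      using assms(1) that by eventually_elim simp
    then show ?thesis
      by simp
  qed
  then show ?thesis
    unfolding upper_limit_def using assms(2) by (intro cInf_lower bdd_belowI[of _ 0]) auto
qed

lemma upper_limit_less:
  assumes "upper_limit X < c" "\<forall>\<^sub>F N in sequentially. X N \<le> B"
  shows "\<forall>\<^sub>F N in sequentially. X N < c"
proof -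
  have "{c. \<forall>\<^sub>F N in sequentially. X N \<le> c} \<noteq> {}"
    using assms(2) by blast
  then obtain c' where "\<forall>\<^sub>F N in sequentially. X N \<le> c'" "c' < c"
    using cInf_lessD[of "{c. \<forall>\<^sub>F N in sequentially. X N \<le> c}" c] assms(1)
    by (auto simp: upper_limit_def)
  then show ?thesis
    by (auto elim: eventually_mono)
qed

lemma upper_limit_ge:
  assumes "\<forall>\<^sub>F N in sequentially. X N \<le> B" "\<And>c. \<forall>\<^sub>F N in sequentially. X N < c \<Longrightarrow> b \<le> c"
  shows "b \<le> upper_limit X"
proof (rule ccontr)
  assume "\<not> b \<le> upper_limit X"
  then obtain c where c: "upper_limit X < c" "c < b"
    using dense[of "upper_limit X" b] by (auto simp: not_le)
  then show False
    using assms(2)[OF upper_limit_less[OF c(1) assms(1)]] by simp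
qed

lemma Limsup_pos_if_frequently_ge:
  fixes f :: "'a \<Rightarrow> ereal"
  assumes "0 < c" "\<exists>\<^sub>F x in F. ereal c \<le> f x"
  shows "0 < Limsup F f"
proof (rule ccontr)
  assume "\<not> ?thesis"
  then have "Limsup F f < ereal c"
    using assms(1) by (simp add: not_less le_less_trans)
  then have "\<forall>\<^sub>F x in F. f x < ereal c"
    by (rule Limsup_lessD)
  then show False
    using assms(2) by (simp add: frequently_def not_le)
qed

lemma neg_log_divide_ge:
  assumes "0 \<le> P" "P \<le> exp (- (M * c))" "0 < M"
  shows "ereal c \<le> neg_log P / ereal M"
proof (cases "P = 0")
  case False
  then have "ln P \<le> - (M * c)"
    using assms ln_mono[of P "exp (- (M * c))"] by simp
  then have "c \<le> - ln P / M"
    using assms(3) by (simp add: field_simps)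
  then show ?thesis
    using False assms(3) by (simp add: neg_log_def)
qed (use assms in \<open>simp add: neg_log_def\<close>)

context unit_interval_law
begin

text \<open>
  A substitute for \<open>exp (- \<tau>q)\<close> that exists at every inverse temperature, also where the quenched
  surface tension is not given. Truncating at \<open>0\<close> makes it monotone on the whole line.
\<close>
definition limit_laplace :: "real \<Rightarrow> (real ^ 'd) set \<Rightarrow> real ^ 'd \<Rightarrow> real \<Rightarrow> real" where
  "limit_laplace q S n \<beta> = upper_limit (\<lambda>N.
     \<integral>J. exp (- surface_tension J q (max 0 \<beta>) 0 (real N) (1 * real N) S n) \<partial>couplings \<mu>)"

context
  fixes q :: real and n :: "real ^ 'd" and S :: "(real ^ 'd) set"
  assumes q: "q \<ge> 1" and S: "bounded S"
begin

lemma limit_laplace_bounds: "0 \<le> limit_laplace q S n \<beta>" "limit_laplace q S n \<beta> \<le> 1"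
proof -
  let ?X = "\<lambda>N. \<integral>J. exp (- surface_tension J q (max 0 \<beta>) 0 (real N) (1 * real N) S n) \<partial>couplings \<mu>"
  have X0: "0 \<le> ?X N" for N
    by simp
  have X1: "\<forall>\<^sub>F N in sequentially. ?X N \<le> 1"
    using eventually_ge_at_top[of "1::nat"]
    by eventually_elim (rule tension_laplace_bounds[OF S _ q], auto)
  show "limit_laplace q S n \<beta> \<le> 1"
    unfolding limit_laplace_def using X0 X1 by (intro upper_limit_le) auto
  show "0 \<le> limit_laplace q S n \<beta>"
    unfolding limit_laplace_def
  proof (rule upper_limit_ge[OF X1])
    fix c assume "\<forall>\<^sub>F N in sequentially. ?X N < c"
    then have "\<exists>N. ?X N < c"
      using eventually_happens' sequentially_bot by blast
    then show "0 \<le> c"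
      using X0 by (meson le_less_trans less_imp_le)
  qed
qed

lemma limit_laplace_antimono: "antimono (limit_laplace q S n)"
proof (rule antimonoI)
  fix \<beta>' \<beta> :: real assume le: "\<beta>' \<le> \<beta>"
  let ?X = "\<lambda>\<beta> N. \<integral>J. exp (- surface_tension J q (max 0 \<beta>) 0 (real N) (1 * real N) S n) \<partial>couplings \<mu>"
  have X1: "\<forall>\<^sub>F N in sequentially. ?X \<beta>' N \<le> 1"
    using eventually_ge_at_top[of "1::nat"]
    by eventually_elim (rule tension_laplace_bounds[OF S _ q], auto)
  have mono: "\<forall>\<^sub>F N in sequentially. ?X \<beta> N \<le> ?X \<beta>' N"
    using eventually_ge_at_top[of "1::nat"]
    by eventually_elim (rule tension_laplace_antimono[OF S _ q], use le in auto)
  show "limit_laplace q S n \<beta> \<le> limit_laplace q S n \<beta>'"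
    unfolding limit_laplace_def[of q S n \<beta>']
  proof (rule upper_limit_ge[OF X1])
    fix c assume "\<forall>\<^sub>F N in sequentially. ?X \<beta>' N < c"
    with mono have "\<forall>\<^sub>F N in sequentially. ?X \<beta> N \<le> c"
      by eventually_elim simp
    then show "limit_laplace q S n \<beta> \<le> c"
      unfolding limit_laplace_def by (intro upper_limit_le) auto
  qed
qed

text \<open>
  The tension is nonnegative, so its Laplace transform exceeds \<open>exp (\<delta> - \<tau>q)\<close> by at most the
  probability of a deviation larger than \<open>\<delta>\<close>.
\<close>
lemma limit_laplace_le_quenched:
  assumes "\<beta> \<ge> 0" "is_quenched_surface_tension \<mu> q \<beta> n \<tau>q" "S \<in> unit_cubes n"
  shows "limit_laplace q S n \<beta> \<le> exp (- \<tau>q)"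
proof (rule field_le_epsilon)
  fix \<epsilon> :: real assume "0 < \<epsilon>"
  let ?X = "\<lambda>N. \<integral>J. exp (- surface_tension J q \<beta> 0 (real N) (1 * real N) S n) \<partial>couplings \<mu>"
  define \<delta> where "\<delta> = ln (1 + \<epsilon> / 2 * exp \<tau>q)"
  have \<delta>: "\<delta> > 0" "exp (\<delta> - \<tau>q) = exp (- \<tau>q) + \<epsilon> / 2"
    using \<open>0 < \<epsilon>\<close> by (auto simp: \<delta>_def exp_diff exp_minus add_pos_pos field_simps)
  let ?P = "\<lambda>N::nat. measure (couplings \<mu>) {J \<in> space (couplings \<mu>).
       \<bar>surface_tension J q \<beta> 0 (real N) (1 * real N) S n - \<tau>q\<bar> > \<delta>}"
  have "?P \<longlonglongrightarrow> 0"
    using assms(2)[unfolded is_quenched_surface_tension_def, rule_format, OF zero_less_one assms(3) \<delta>(1)] .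
  then have "\<forall>\<^sub>F N in sequentially. ?P N < \<epsilon> / 2"
    using \<open>0 < \<epsilon>\<close> by (intro order_tendstoD) auto
  then have "\<forall>\<^sub>F N in sequentially. ?X N \<le> exp (- \<tau>q) + \<epsilon>"
    using eventually_ge_at_top[of "1::nat"]
  proof eventually_elim
    case (elim N)
    then show ?case
      using tension_laplace_le_exp[OF S _ q assms(1), of "real N" 0 "1 * real N" n \<delta> \<tau>q] \<delta>(2)
      by simp
  qed
  then show "limit_laplace q S n \<beta> \<le> exp (- \<tau>q) + \<epsilon>"
    unfolding limit_laplace_def using assms(1) by (intro upper_limit_le) auto
qed

section \<open>The quadratic lower bound on the rate function\<close>

text \<open>
  The Chernoff bound with \<open>p = \<kappa> * N ^ (d - 1)\<close>, where \<open>\<kappa>\<close> is the largest constant that the step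
  from \<open>\<beta>\<close> down to \<open>\<beta>'\<close> can pay for.
\<close>
lemma rate_function_lower_bound:
  assumes d: "CARD('d) \<ge> 2" and \<beta>': "0 \<le> \<beta>'" "\<beta>' < \<beta>" and cube: "S \<in> unit_cubes n"
    and rate: "is_rate_function \<mu> q \<beta> n \<tau>min I" and t: "t > \<tau>min"
    and laplace: "limit_laplace q S n \<beta>' < exp (- \<sigma>)"
  shows "ereal (2 * (\<beta> - \<beta>') * exp (- \<beta>) / \<beta>\<^sup>2 * (\<sigma> - t)) \<le> I t"
proof -
  define \<kappa> where "\<kappa> = 2 * (\<beta> - \<beta>') * exp (- \<beta>) / \<beta>\<^sup>2"
  have \<kappa>: "\<kappa> > 0" "\<kappa> * \<beta>\<^sup>2 = 2 * (\<beta> - \<beta>') * exp (- \<beta>)"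
    using \<beta>' by (auto simp: \<kappa>_def)
  let ?X = "\<lambda>N::nat. \<integral>J. exp (- surface_tension J q \<beta>' 0 (real N) (1 * real N) S n) \<partial>couplings \<mu>"
  let ?P = "\<lambda>N::nat. measure (couplings \<mu>)
    {J \<in> space (couplings \<mu>). surface_tension J q \<beta> 0 (real N) (1 * real N) S n \<le> t}"
  let ?M = "\<lambda>N::nat. real N ^ (CARD('d) - 1)"
  have lim: "(\<lambda>N. neg_log (?P N) / ereal (?M N)) \<longlonglongrightarrow> I t"
    using rate[unfolded is_rate_function_def, THEN conjunct1, rule_format, OF t, THEN conjunct2,
        THEN conjunct2, rule_format, OF zero_less_one cube] .
  have "\<forall>\<^sub>F N in sequentially. ?X N \<le> 1"
    using eventually_ge_at_top[of "1::nat"]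
    by eventually_elim (rule tension_laplace_bounds[OF S _ q], use \<beta>' in auto)
  then have X: "\<forall>\<^sub>F N in sequentially. ?X N < exp (- \<sigma>)"
    using laplace \<beta>' by (intro upper_limit_less) (auto simp: limit_laplace_def)
  have large: "\<forall>\<^sub>F N in sequentially. 1 / \<kappa> \<le> real N"
    using filterlim_real_sequentially by (simp add: filterlim_at_top)
  have "\<forall>\<^sub>F N in sequentially. ereal (\<kappa> * (\<sigma> - t)) \<le> neg_log (?P N) / ereal (?M N)"
    using X large eventually_ge_at_top[of "1::nat"]
  proof eventually_elim
    case (elim N)
    have M: "?M N > 0" "real N \<le> ?M N"
      using elim(3) d self_le_power[of "real N" "CARD('d) - 1"] by auto
    define p where "p = \<kappa> * ?M N"
    have "1 \<le> \<kappa> * real N"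
      using elim(2) \<kappa>(1) by (simp add: field_simps)
    also have "\<dots> \<le> p"
      unfolding p_def using M \<kappa>(1) by (intro mult_left_mono) auto
    finally have p: "p \<ge> 1" .
    have "?P N \<le> exp (p * t) * ?X N powr p"
    proof (rule prob_tension_le[OF S _ q])
      show "p * \<beta>\<^sup>2 \<le> 2 * (\<beta> - \<beta>') * exp (- \<beta>) * real N ^ (CARD('d) - 1)"
        unfolding \<kappa>(2)[symmetric] p_def by (simp add: mult_ac)
    qed (use elim(3) p \<beta>' in auto)
    also have "\<dots> \<le> exp (p * t) * exp (- \<sigma>) powr p"
      using elim(1) p by (intro mult_left_mono powr_mono2) auto
    also have "\<dots> = exp (- (?M N * (\<kappa> * (\<sigma> - t))))"
      by (simp add: p_def powr_def mult_exp_exp algebra_simps)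
    finally have P: "?P N \<le> exp (- (?M N * (\<kappa> * (\<sigma> - t))))" .
    show "ereal (\<kappa> * (\<sigma> - t)) \<le> neg_log (?P N) / ereal (?M N)"
      by (rule neg_log_divide_ge[OF measure_nonneg P M(1)])
  qed
  then show ?thesis
    using lim unfolding \<kappa>_def[symmetric] by (intro tendsto_lowerbound) auto
qed

text \<open>
  Let \<open>h\<close> be a step for which the left difference quotient of the Laplace transform is controlled. At
  \<open>\<beta> - h\<close> the effective tension \<open>- ln (limit_laplace q S n (\<beta> - h))\<close> is at least \<open>\<tau>q - D * h\<close>, so with
  \<open>r = 2 * D * h\<close> half of the deviation \<open>r\<close> remains, and the gain \<open>\<kappa> * h * (D * h)\<close> is of order \<open>r\<^sup>2\<close>.
\<close>
lemma Limsup_rate_function_pos: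
  assumes d: "CARD('d) \<ge> 2" and \<beta>: "0 < \<beta>" and cube: "S \<in> unit_cubes n"
    and quotient: "\<exists>\<^sub>F k in sequentially. limit_laplace q S n (\<beta> - inverse (real (Suc k)))
      \<le> limit_laplace q S n \<beta> + C * inverse (real (Suc k))"
    and quenched: "is_quenched_surface_tension \<mu> q \<beta> n \<tau>q"
    and rate: "is_rate_function \<mu> q \<beta> n \<tau>min I"
  shows "0 < Limsup (at_right 0) (\<lambda>r::real. I (\<tau>q - r) / ereal (r ^ 2))"
proof -
  \<comment> \<open>An increase \<open>C * h\<close> of the transform is relative to its size \<open>exp (- \<tau>q)\<close>; adding \<open>1\<close> makes the bound strict.\<close>
  define D where "D = (max C 0 + 1) * exp \<tau>q"
  have D: "D > 0"
    by (simp add: D_def)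
  define \<kappa> where "\<kappa> = 2 * exp (- \<beta>) / \<beta>\<^sup>2"
  have \<kappa>: "\<kappa> > 0"
    using \<beta> by (simp add: \<kappa>_def)
  define h where "h k = inverse (real (Suc k))" for k
  define r where "r k = 2 * D * h k" for k
  have h: "h k > 0" for k
    by (simp add: h_def)
  have h0: "h \<longlonglongrightarrow> 0"
    unfolding h_def by (rule LIMSEQ_inverse_real_of_nat)
  have "r \<longlonglongrightarrow> 2 * D * 0"
    unfolding r_def by (intro tendsto_intros h0)
  then have r0: "r \<longlonglongrightarrow> 0"
    by simp
  have r: "r k > 0" for k
    using h D by (simp add: r_def)
  \<comment> \<open>At the single point \<open>\<tau>min\<close> the rate function is defined as a limit from the right; it is avoided.\<close>
  have "\<forall>\<^sub>F k in sequentially. \<tau>q - r k \<noteq> \<tau>min"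
  proof (cases "\<tau>min < \<tau>q")
    case True
    then have "\<forall>\<^sub>F k in sequentially. r k < \<tau>q - \<tau>min"
      using r0 by (intro order_tendstoD) auto
    then show ?thesis
      by eventually_elim auto
  next
    case False
    then have "\<tau>q - r k \<noteq> \<tau>min" for k
      using r[of k] by linarith
    then show ?thesis
      by simp
  qed
  moreover have "\<forall>\<^sub>F k in sequentially. h k < \<beta>"
    using h0 \<beta> by (rule order_tendstoD)
  ultimately have ev: "\<forall>\<^sub>F k in sequentially. \<tau>q - r k \<noteq> \<tau>min \<and> h k < \<beta>"
    by eventually_elim simp
  have "ereal (\<kappa> / (4 * D)) \<le> I (\<tau>q - r k) / ereal ((r k) ^ 2)"
    if k: "\<tau>q - r k \<noteq> \<tau>min" "h k < \<beta>"
      and q: "limit_laplace q S n (\<beta> - h k) \<le> limit_laplace q S n \<beta> + C * h k" for k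
  proof (cases "\<tau>q - r k < \<tau>min")
    case True
    then have "I (\<tau>q - r k) = \<infinity>"
      using rate by (simp add: is_rate_function_def)
    then show ?thesis
      using r[of k] by simp
  next
    case False
    have "limit_laplace q S n (\<beta> - h k) \<le> exp (- \<tau>q) + C * h k"
      using q limit_laplace_le_quenched[OF _ quenched cube] \<beta> by simp
    also have "\<dots> < exp (- \<tau>q) + (max C 0 + 1) * h k"
      using h by (intro add_strict_left_mono mult_strict_right_mono) auto
    also have "\<dots> = exp (- \<tau>q) * (1 + D * h k)"
      by (simp add: D_def exp_minus field_simps)
    also have "\<dots> \<le> exp (- \<tau>q) * exp (D * h k)"
      using exp_ge_add_one_self by (intro mult_left_mono) auto
    also have "\<dots> = exp (- (\<tau>q - D * h k))"
      by (simp add: mult_exp_exp)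
    finally have "limit_laplace q S n (\<beta> - h k) < exp (- (\<tau>q - D * h k))" .
    then have "ereal (2 * (\<beta> - (\<beta> - h k)) * exp (- \<beta>) / \<beta>\<^sup>2 * ((\<tau>q - D * h k) - (\<tau>q - r k))) \<le> I (\<tau>q - r k)"
      using k False h[of k] by (intro rate_function_lower_bound[OF d _ _ cube rate]) auto
    also have "2 * (\<beta> - (\<beta> - h k)) * exp (- \<beta>) / \<beta>\<^sup>2 * ((\<tau>q - D * h k) - (\<tau>q - r k))
        = \<kappa> / (4 * D) * (r k)\<^sup>2"
      using D by (simp add: \<kappa>_def r_def power2_eq_square field_simps)
    finally show ?thesis
      using r[of k] by (cases "I (\<tau>q - r k)") (auto simp: field_simps)
  qed
  note bound = this
  have "\<exists>\<^sub>F k in sequentially. ereal (\<kappa> / (4 * D)) \<le> I (\<tau>q - r k) / ereal ((r k) ^ 2)"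
    using frequently_eventually_frequently[OF quotient[folded h_def] ev]
    by (rule frequently_elim1) (intro bound, simp_all)
  moreover have "filterlim r (at_right 0) sequentially"
    using r0 r by (intro tendsto_imp_filterlim_at_right always_eventually) auto
  ultimately have "\<exists>\<^sub>F r in at_right 0. ereal (\<kappa> / (4 * D)) \<le> I (\<tau>q - r) / ereal (r ^ 2)"
    unfolding frequently_def by (auto dest: eventually_compose_filterlim)
  then show ?thesis
    using \<kappa> D by (intro Limsup_pos_if_frequently_ge[where c = "\<kappa> / (4 * D)"]) auto
qed

end

end

lemma unit_cubes_nonempty:
  fixes n :: "real ^ 'd"
  assumes "norm n = 1"
  obtains S where "S \<in> unit_cubes n"
proof -
  obtain B where B: "n \<in> B" "pairwise orthogonal B" "\<And>x. x \<in> B \<Longrightarrow> norm x = 1" "span B = UNIV"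
    using vector_in_orthonormal_basis[OF assms] by metis
  let ?S = "{\<Sum>u\<in>B - {n}. t u *\<^sub>R u | t. \<forall>u\<in>B - {n}. t u \<in> {-1/2..1/2}}"
  have "?S \<in> unit_cubes n"
    unfolding unit_cubes_def by (intro CollectI exI[of _ B] conjI refl ballI B)
  then show ?thesis
    by (rule that)
qed

theorem theorem1p8:
  fixes \<mu> :: "real measure" and q :: real and n :: "real ^ 'd"
  assumes "CARD('d) \<ge> 2" and "q \<ge> 1"
    and "prob_space \<mu>" and "sets \<mu> = sets (restrict_space borel {0..1})"
    and "norm n = 1"
  shows "AE \<beta> in lebesgue. \<beta> \<ge> 0 \<longrightarrow>
           (\<forall>\<tau>q \<tau>min I.
              is_quenched_surface_tension \<mu> q \<beta> n \<tau>q \<longrightarrow>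
              is_minimal_surface_tension \<mu> q \<beta> n \<tau>min \<longrightarrow>
              is_rate_function \<mu> q \<beta> n \<tau>min I \<longrightarrow>
              Limsup (at_right 0) (\<lambda>r::real. I (\<tau>q - r) / ereal (r ^ 2)) > 0)"
proof -
  interpret unit_interval_law \<mu>
    using assms(3,4) by (simp add: unit_interval_law_def unit_interval_law_axioms_def)
  obtain S where cube: "S \<in> unit_cubes n"
    using unit_cubes_nonempty[OF assms(5)] .
  then have S: "bounded S"
    by (rule unit_cube_bounded)
  have "AE \<beta> in lborel. \<exists>C. \<exists>\<^sub>F k in sequentially.
      limit_laplace q S n (\<beta> - inverse (real (Suc k))) \<le> limit_laplace q S n \<beta> + C * inverse (real (Suc k))"
    by (intro AE_bounded_left_difference_quotient limit_laplace_antimono limit_laplace_bounds assms(2) S)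
  moreover have "AE \<beta> in lborel. \<beta> \<noteq> (0::real)"
    by (rule AE_lborel_singleton)
  ultimately have "AE \<beta> in lborel. \<beta> \<ge> 0 \<longrightarrow>
           (\<forall>\<tau>q \<tau>min I.
              is_quenched_surface_tension \<mu> q \<beta> n \<tau>q \<longrightarrow>
              is_minimal_surface_tension \<mu> q \<beta> n \<tau>min \<longrightarrow>
              is_rate_function \<mu> q \<beta> n \<tau>min I \<longrightarrow>
              Limsup (at_right 0) (\<lambda>r::real. I (\<tau>q - r) / ereal (r ^ 2)) > 0)"
  proof eventually_elim
    case (elim \<beta>)
    then obtain C where C: "\<exists>\<^sub>F k in sequentially.
        limit_laplace q S n (\<beta> - inverse (real (Suc k))) \<le> limit_laplace q S n \<beta> + C * inverse (real (Suc k))"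
      by blast
    show ?case
    proof (intro impI allI)
      fix \<tau>q \<tau>min I
      assume "\<beta> \<ge> 0" and lims: "is_quenched_surface_tension \<mu> q \<beta> n \<tau>q" "is_rate_function \<mu> q \<beta> n \<tau>min I"
      then have "0 < \<beta>"
        using elim(2) by simp
      then show "0 < Limsup (at_right 0) (\<lambda>r::real. I (\<tau>q - r) / ereal (r ^ 2))"
        by (rule Limsup_rate_function_pos[OF assms(2) S assms(1) _ cube C lims])
    qed
  qed
  then show ?thesis
    by (rule AE_completion)
qed

end
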